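(* Let $K:X\to Y$ be a nonzero compact linear operator between Hilbert spaces with singular system $(\mu_j,x_j,y_j)$, let $r\ge\frac12$, $l\in\mathbb{N}$, and let $m\ge1$ be an integer. For $\alpha>0$ and $y\in Y$ let $x^{m,\alpha}$ be the $m$-th iterate of the iterated fractional weighted Tikhonov method, defined by $x^{0,\alpha}=0$ and, for $k=1,2,\dots$, $$\left(K^*K+\alpha\left(I-\tfrac{K^*K}{\|K^*K\|}\right)^{l}\right)^{r}x^{k,\alpha}=(K^*K)^{r-1}K^*y+\left[\left(K^*K+\alpha\left(I-\tfrac{K^*K}{\|K^*K\|}\right)^{l}\right)^{r}-(K^*K)^{r}\right]x^{k-1,\alpha},$$ and let $x^{m,\alpha,\delta}$ be the $m$-th iterate when $y$ is replaced by the noisy data $y^\delta$. Then: (i) The method is a filter based regularization method, i.e. $x^{m,\alpha}=\sum_{j}\frac{Q_l^{m,r}(\alpha,\mu_j)}{\mu_j}(y,y_j)x_j$, with filter function $$Q_l^{m,r}(\alpha,\mu)=1-\left(1-Q_l^{r}(\alpha,\mu)\right)^m,\qquad Q_l^r(\alpha,\mu)=\left(\frac{\mu^2}{\mu^2+\alpha\left(1-\left(\frac{\mu}{\mu_1}\right)^2\right)^l}\right)^r.$$ (ii) Moreover, the method is of optimal order under the a-priori assumption $x\in X_{\sigma,E}$, for $l\in\mathbb{N}$ and $0\le\sigma\le 2m$ (and $E>0$). (iii) Further, the regularization parameter $\alpha=\left(\frac{\delta}{E}\right)^{\frac{2m}{1+\sigma}}$ yields the best convergence rate $\|x-x^{m,\alpha,\delta}\|\le\mathcal{O}\left(\delta^{\frac{2m}{2m+1}}\right)$,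 with $\sigma=2m$. Here $y=Kx$ and $\|y-y^\delta\|\le\delta$.
   Context: $X,Y$ are Hilbert spaces and $K:X\to Y$ is compact and linear. A singular system $(\mu_j,x_j,y_j)$ of $K$ consists of the positive singular values $\mu_1\ge\mu_2\ge\dots>0$ and orthonormal systems $(x_j)\subset X$, $(y_j)\subset Y$ with $Kx_j=\mu_jy_j$, $K^*y_j=\mu_jx_j$, where $(x_j)$ is complete in $N(K)^\perp$. $\mathbb{N}$ includes $0$; for $l=0$ the factor $(1-(\mu/\mu_1)^2)^l$ is identically $1$ and $(I-K^*K/\|K^*K\|)^l=I$. Powers of nonnegative self-adjoint operators are taken in the sense of functional calculus, and $(K^*K)^{r-1}K^*$ denotes the bounded operator $y\mapsto\sum_j\mu_j^{2r-1}(y,y_j)x_j$. Filter based regularization method: a family $R_\alpha y=\sum_j \frac{q(\alpha,\mu_j)}{\mu_j}(y,y_j)x_j$, $\alpha>0$, where the filter function $q$ satisfies: $\sup_{j}|q(\alpha,\mu_j)/\mu_j|=c(\alpha)<\infty$; $|q(\alpha,\mu_j)|\le c<\infty$ with $c$ independent of $\alpha$ and $j$; and $\lim_{\alpha\to0}q(\alpha,\mu_j)=1$ pointwise in $\mu_j$. Source sets: $X_{\sigma,E}=\{x\in X:\ \exists z\in X,\ \|z\|\le E,\ x=(K^*K)^{\sigma/2}z\}$, with $(K^*K)^0=I$. Optimal order: for exact data $y=Kx$ and noisy data $y^\delta$ with $\|y-y^\delta\|\le\delta$, write $x^{\alpha,\delta}=R_\alpha y^\delta$. The regularization method $R_\alpha$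 is of optimal order under the a-priori assumption $x\in X_{\sigma,E}$ if, with an a-priori choice of the regularization parameter $\alpha=\alpha(\delta,E)$, for $\delta>0$, $$\sup\{\|x-x^{\alpha,\delta}\|:\ x\in X_{\sigma,E},\ \|y-y^\delta\|\le\delta\}\le c\,\delta^{\frac{\sigma}{\sigma+1}}E^{\frac1{\sigma+1}}$$ holds with a constant $c$ independent of $\delta$ and $E$.
   Formalization: (ii) for l≥1 is stated for δ≤ME, any M>0, with c depending on M, as it fails when δ/E is unbounded; (iii) uses α=(δ/E)^{2/(1+σ)}, as the printed exponent 2m/(1+σ) fails for m≥2 and infinite rank; Hilbert spaces are real. *)

theory Defs
  imports "HOL-Analysis.Analysis" "HOL-Computational_Algebra.Polynomial"
begin

text \<open>Hilbert spaces are types of sort \<open>{real_inner, banach}\<close>.\<close>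

definition compact_operator :: "('a::real_normed_vector \<Rightarrow> 'b::real_normed_vector) \<Rightarrow> bool" where
  "compact_operator K \<longleftrightarrow> linear K \<and> (\<forall>S. bounded S \<longrightarrow> compact (closure (K ` S)))"

text \<open>The index set is an initial segment of the positive integers or all of them,
  according to the rank of \<open>K\<close>, so \<open>\<mu> 1\<close> is the largest singular value.\<close>

definition singular_system ::
  "('a::real_inner \<Rightarrow> 'b::real_inner) \<Rightarrow> nat set \<Rightarrow> (nat \<Rightarrow> real) \<Rightarrow> (nat \<Rightarrow> 'a) \<Rightarrow> (nat \<Rightarrow> 'b) \<Rightarrow> bool"
where
  "singular_system K J \<mu> x y \<longleftrightarrow>
     (J = {1..} \<or> (\<exists>n. J = {1..n})) \<and>
     (\<forall>j\<in>J. 0 < \<mu> j) \<and>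
     (\<forall>i\<in>J. \<forall>j\<in>J. i \<le> j \<longrightarrow> \<mu> j \<le> \<mu> i) \<and>
     (\<forall>i\<in>J. \<forall>j\<in>J. x i \<bullet> x j = (if i = j then 1 else 0)) \<and>
     (\<forall>i\<in>J. \<forall>j\<in>J. y i \<bullet> y j = (if i = j then 1 else 0)) \<and>
     (\<forall>j\<in>J. K (x j) = \<mu> j *\<^sub>R y j \<and> adjoint K (y j) = \<mu> j *\<^sub>R x j) \<and>
     closure (span (x ` J)) = orthogonal_comp {v. K v = 0}"

text \<open>Continuous functional calculus of a bounded self-adjoint operator \<open>A \<ge> 0\<close>. The spectrum
  of \<open>A\<close> lies in \<open>[0, \<parallel>A\<parallel>]\<close>, and \<open>f(A)\<close> is the limit in operator norm of \<open>p\<^sub>n(A)\<close> for polynomials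
  \<open>p\<^sub>n\<close> tending to \<open>f\<close> uniformly on that interval.\<close>

definition poly_operator :: "real poly \<Rightarrow> ('a::real_normed_vector \<Rightarrow> 'a) \<Rightarrow> 'a \<Rightarrow> 'a" where
  "poly_operator p A = (\<lambda>v. \<Sum>i\<le>degree p. coeff p i *\<^sub>R (A ^^ i) v)"

definition functional_calculus ::
  "('a::real_normed_vector \<Rightarrow> 'a) \<Rightarrow> (real \<Rightarrow> real) \<Rightarrow> 'a \<Rightarrow> 'a"
where
  "functional_calculus A f =
     (THE B. bounded_linear B \<and>
        (\<exists>p :: nat \<Rightarrow> real poly.
           uniform_limit {0..onorm A} (\<lambda>n. poly (p n)) f sequentially \<and>
           (\<lambda>n. onorm (\<lambda>v. poly_operator (p n) A v - B v)) \<longlonglongrightarrow> 0))"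

text \<open>The case \<open>s = 0\<close> is separate because \<open>0 powr 0 = 0\<close>, whereas \<open>A\<^sup>0 = I\<close>.\<close>

definition operator_power :: "('a::real_normed_vector \<Rightarrow> 'a) \<Rightarrow> real \<Rightarrow> 'a \<Rightarrow> 'a" where
  "operator_power A s = functional_calculus A (\<lambda>t. if s = 0 then 1 else t powr s)"

definition normal_operator :: "('a::real_inner \<Rightarrow> 'b::real_inner) \<Rightarrow> 'a \<Rightarrow> 'a" where
  "normal_operator K = (\<lambda>v. adjoint K (K v))"

definition source_set :: "('a::real_inner \<Rightarrow> 'b::real_inner) \<Rightarrow> real \<Rightarrow> real \<Rightarrow> 'a set" where
  "source_set K \<sigma> E = {operator_power (normal_operator K) (\<sigma> / 2) z | z. norm z \<le> E}"

definition filter_function :: "nat set \<Rightarrow> (nat \<Rightarrow> real) \<Rightarrow> (real \<Rightarrow> real \<Rightarrow> real) \<Rightarrow> bool" where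
  "filter_function J \<mu> q \<longleftrightarrow>
     (\<forall>\<alpha>>0. bdd_above ((\<lambda>j. \<bar>q \<alpha> (\<mu> j) / \<mu> j\<bar>) ` J)) \<and>
     (\<exists>c. \<forall>\<alpha>>0. \<forall>j\<in>J. \<bar>q \<alpha> (\<mu> j)\<bar> \<le> c) \<and>
     (\<forall>j\<in>J. ((\<lambda>\<alpha>. q \<alpha> (\<mu> j)) \<longlongrightarrow> 1) (at_right 0))"

definition filter_based_regularization ::
  "nat set \<Rightarrow> (nat \<Rightarrow> real) \<Rightarrow> (nat \<Rightarrow> 'a::real_inner) \<Rightarrow> (nat \<Rightarrow> 'b::real_inner) \<Rightarrow>
   (real \<Rightarrow> real \<Rightarrow> real) \<Rightarrow> (real \<Rightarrow> 'b \<Rightarrow> 'a) \<Rightarrow> bool"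
where
  "filter_based_regularization J \<mu> x y q R \<longleftrightarrow>
     filter_function J \<mu> q \<and>
     (\<forall>\<alpha>>0. \<forall>w. ((\<lambda>j. (q \<alpha> (\<mu> j) / \<mu> j * (w \<bullet> y j)) *\<^sub>R x j) has_sum R \<alpha> w) J)"

text \<open>In \<open>worst_case_error K S \<sigma> E \<delta>\<close> the map \<open>S\<close> is the reconstruction operator for one fixed
  value of the regularization parameter; the supremum may be infinite.\<close>

definition worst_case_error ::
  "('a::real_inner \<Rightarrow> 'b::real_inner) \<Rightarrow> ('b \<Rightarrow> 'a) \<Rightarrow> real \<Rightarrow> real \<Rightarrow> real \<Rightarrow> ereal"
where
  "worst_case_error K S \<sigma> E \<delta> =
     (SUP (x, w) \<in> {(x, w). x \<in> source_set K \<sigma> E \<and> norm (K x - w) \<le> \<delta>}. ereal (norm (x - S w)))"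

text \<open>Order optimality with one constant for all pairs \<open>(\<delta>, E) \<in> D\<close> of noise level and source
  radius. A filter with \<open>q(\<alpha>, \<mu>\<^sub>1) = 1\<close> for all \<open>\<alpha>\<close> (as \<open>fwt_filter\<close> below for \<open>l \<ge> 1\<close>) has
  worst-case error at least \<open>\<delta> / \<mu>\<^sub>1\<close>, so it cannot be of optimal order on a set \<open>D\<close> with unbounded
  ratios \<open>\<delta> / E\<close>.\<close>

definition optimal_order_on ::
  "(real \<times> real) set \<Rightarrow> ('a::real_inner \<Rightarrow> 'b::real_inner) \<Rightarrow> (real \<Rightarrow> 'b \<Rightarrow> 'a) \<Rightarrow> real \<Rightarrow> bool"
where
  "optimal_order_on D K R \<sigma> \<longleftrightarrow>
     (\<exists>(a :: real \<Rightarrow> real \<Rightarrow> real) c. \<forall>\<delta>>0. \<forall>E>0. (\<delta>, E) \<in> D \<longrightarrow>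
        0 < a \<delta> E \<and>
        worst_case_error K (R (a \<delta> E)) \<sigma> E \<delta>
          \<le> ereal (c * \<delta> powr (\<sigma> / (\<sigma> + 1)) * E powr (1 / (\<sigma> + 1))))"

abbreviation optimal_order ::
  "('a::real_inner \<Rightarrow> 'b::real_inner) \<Rightarrow> (real \<Rightarrow> 'b \<Rightarrow> 'a) \<Rightarrow> real \<Rightarrow> bool"
where
  "optimal_order \<equiv> optimal_order_on UNIV"

text \<open>\<open>K\<^sup>*K + \<alpha> (I - K\<^sup>*K / \<parallel>K\<^sup>*K\<parallel>)\<^sup>l\<close>\<close>

definition weighted_operator ::
  "('a::real_inner \<Rightarrow> 'b::real_inner) \<Rightarrow> nat \<Rightarrow> real \<Rightarrow> 'a \<Rightarrow> 'a"
where
  "weighted_operator K l \<alpha> = (\<lambda>v. normal_operator K v +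
     \<alpha> *\<^sub>R ((\<lambda>u. u - (1 / onorm (normal_operator K)) *\<^sub>R normal_operator K u) ^^ l) v)"

text \<open>The bounded operator \<open>(K\<^sup>*K)\<^sup>r\<^sup>-\<^sup>1 K\<^sup>*\<close>, for \<open>r \<ge> 1/2\<close>; for \<open>r < 1\<close> the first factor alone would
  be unbounded.\<close>

definition fractional_adjoint ::
  "nat set \<Rightarrow> (nat \<Rightarrow> real) \<Rightarrow> (nat \<Rightarrow> 'a::real_inner) \<Rightarrow> (nat \<Rightarrow> 'b::real_inner) \<Rightarrow> real \<Rightarrow> 'b \<Rightarrow> 'a"
where
  "fractional_adjoint J \<mu> x y r w = (\<Sum>\<^sub>\<infinity>j\<in>J. (\<mu> j powr (2 * r - 1) * (w \<bullet> y j)) *\<^sub>R x j)"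

text \<open>Iterated fractional weighted Tikhonov: the \<open>k\<close>-th iterate for parameter \<open>\<alpha>\<close> and data \<open>w\<close>, each step being the solution of the
  linear equation that defines it implicitly.\<close>

primrec ifwt ::
  "('a::real_inner \<Rightarrow> 'b::real_inner) \<Rightarrow> nat set \<Rightarrow> (nat \<Rightarrow> real) \<Rightarrow> (nat \<Rightarrow> 'a) \<Rightarrow> (nat \<Rightarrow> 'b) \<Rightarrow>
   real \<Rightarrow> nat \<Rightarrow> nat \<Rightarrow> real \<Rightarrow> 'b \<Rightarrow> 'a"
where
  "ifwt K J \<mu> x y r l 0 \<alpha> w = 0"
| "ifwt K J \<mu> x y r l (Suc k) \<alpha> w =
     (THE u. operator_power (weighted_operator K l \<alpha>) r u =
        fractional_adjoint J \<mu> x y r w +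
        (operator_power (weighted_operator K l \<alpha>) r (ifwt K J \<mu> x y r l k \<alpha> w) -
         operator_power (normal_operator K) r (ifwt K J \<mu> x y r l k \<alpha> w)))"

definition fwt_filter :: "real \<Rightarrow> real \<Rightarrow> nat \<Rightarrow> real \<Rightarrow> real \<Rightarrow> real" where
  "fwt_filter \<mu>1 r l \<alpha> \<mu> = (\<mu>\<^sup>2 / (\<mu>\<^sup>2 + \<alpha> * (1 - (\<mu> / \<mu>1)\<^sup>2) ^ l)) powr r"

definition ifwt_filter :: "real \<Rightarrow> real \<Rightarrow> nat \<Rightarrow> nat \<Rightarrow> real \<Rightarrow> real \<Rightarrow> real" where
  "ifwt_filter \<mu>1 r l m \<alpha> \<mu> = 1 - (1 - fwt_filter \<mu>1 r l \<alpha> \<mu>) ^ m"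

end

theory Submission
  imports Defs
begin

text \<open>Since \<open>N(K)\<^sup>\<bottom>\<close> is spanned by the orthonormal system \<open>x\<close>, every function \<open>h(K\<^sup>*K)\<close> acts
  by \<open>h(\<mu>\<^sub>j\<^sup>2)\<close> on \<open>x\<^sub>j\<close> and by \<open>h(0)\<close> on the kernel, so the implicit equation of the method is a scalar
  recursion \<open>Q\<^sub>k\<^sub>+\<^sub>1 = q + (1 - q) Q\<^sub>k\<close> in each coordinate. With \<open>t = \<mu>\<^sup>2\<close> the residual satisfies
  \<open>1 - q \<le> \<lceil>r\<rceil> \<alpha> / (t + \<alpha>)\<close>, hence \<open>(1 - q)\<^sup>m t\<^sup>\<sigma>\<^sup>/\<^sup>2 = O(\<alpha>\<^sup>\<sigma>\<^sup>/\<^sup>2)\<close> for \<open>\<sigma> \<le> 2m\<close>, while \<open>r \<ge> 1/2\<close> gives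
  \<open>Q\<^sub>m / \<mu> \<le> m (t + \<alpha> (1 - t / \<mu>\<^sub>1\<^sup>2)\<^sup>l)\<^sup>-\<^sup>1\<^sup>/\<^sup>2 = O(\<alpha>\<^sup>-\<^sup>1\<^sup>/\<^sup>2)\<close> for bounded \<open>\<alpha>\<close>. The choice
  \<open>\<alpha> = (\<delta>/E)\<^sup>2\<^sup>/\<^sup>(\<^sup>1\<^sup>+\<^sup>\<sigma>\<^sup>)\<close> balances the two errors.\<close>

subsection \<open>Orthogonal projection in Hilbert spaces\<close>

text \<open>A minimizing sequence for the distance from \<open>v\<close> to \<open>S\<close> is
  Cauchy by the parallelogram law. Completeness gives a nearest point \<open>p\<close>, and
  minimality makes \<open>v - p\<close> orthogonal to \<open>S\<close>.\<close>

lemma closed_subspace_orthogonal_projection: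
  fixes S :: "'a::{real_inner, banach} set"
  assumes S: "subspace S" "closed S"
  obtains p where "p \<in> S" "\<And>s. s \<in> S \<Longrightarrow> (v - p) \<bullet> s = 0"
proof -
  define d where "d = infdist v S"
  have ne: "S \<noteq> {}" using S subspace_0 by blast
  have d_le: "d \<le> norm (v - s)" if "s \<in> S" for s
    using infdist_le[OF that, of v] by (simp add: d_def dist_norm)
  have d0: "0 \<le> d" by (simp add: d_def infdist_nonneg)
  \<comment> \<open>The excess is measured in squared distances, so that the parallelogram identity
    applies without taking roots.\<close>
  have "\<exists>s\<in>S. norm (v - s) ^ 2 < d\<^sup>2 + inverse (real (Suc n))" for n
  proof -
    have "d < sqrt (d\<^sup>2 + inverse (real (Suc n)))"
      using d0 by (simp add: real_less_rsqrt)
    then obtain s where s: "s \<in> S" "dist v s < sqrt (d\<^sup>2 + inverse (real (Suc n)))"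
      unfolding d_def infdist_def using ne by (auto simp: cInf_less_iff)
    then have "norm (v - s) ^ 2 < d\<^sup>2 + inverse (real (Suc n))"
      using real_sqrt_less_iff[of "(norm (v - s))\<^sup>2"] by (simp add: dist_norm)
    then show ?thesis using s by blast
  qed
  then obtain s where s: "\<And>n. s n \<in> S" "\<And>n. norm (v - s n) ^ 2 < d\<^sup>2 + inverse (real (Suc n))"
    by metis
  \<comment> \<open>In the parallelogram identity the midpoint lies in \<open>S\<close>, hence at
    distance at least \<open>d\<close> from \<open>v\<close>; all multiples of \<open>d\<close>
    squared cancel and only the excesses remain.\<close>
  have near: "norm (s i - s j) ^ 2 < 2 * inverse (real (Suc i)) + 2 * inverse (real (Suc j))" for i j
  proof -
    have mid: "(1 / 2) *\<^sub>R (s i + s j) \<in> S"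
      using S(1) s(1) by (simp add: subspace_add subspace_scale)
    have "norm (s i - s j) ^ 2 = 2 * norm (v - s i) ^ 2 + 2 * norm (v - s j) ^ 2
        - 4 * norm (v - (1 / 2) *\<^sub>R (s i + s j)) ^ 2"
      by (simp add: power2_norm_eq_inner inner_commute algebra_simps inner_diff_left inner_add_left)
    moreover have "norm (v - (1 / 2) *\<^sub>R (s i + s j)) ^ 2 \<ge> d\<^sup>2"
      using d_le[OF mid] d0 by simp
    ultimately show ?thesis using s(2)[of i] s(2)[of j] by linarith
  qed
  have "Cauchy s"
  proof (rule metric_CauchyI)
    fix e :: real assume e: "0 < e"
    obtain N where N: "inverse (real (Suc N)) < e\<^sup>2 / 4"
      using reals_Archimedean[of "e\<^sup>2 / 4"] e by auto
    have "dist (s i) (s j) < e" if "i \<ge> N" "j \<ge> N" for i j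
    proof -
      have "inverse (real (Suc i)) \<le> inverse (real (Suc N))" "inverse (real (Suc j)) \<le> inverse (real (Suc N))"
        using that by (auto intro!: le_imp_inverse_le)
      then have "norm (s i - s j) ^ 2 < e\<^sup>2" using near[of i j] N by linarith
      then show ?thesis using e by (simp add: dist_norm power_less_imp_less_base)
    qed
    then show "\<exists>M. \<forall>m\<ge>M. \<forall>n\<ge>M. dist (s m) (s n) < e" by blast
  qed
  then obtain p where p: "s \<longlonglongrightarrow> p" by (meson Cauchy_convergent convergent_def)
  have pS: "p \<in> S" using S(2) s(1) p closed_sequentially by blast
  have "(\<lambda>n. norm (v - s n) ^ 2) \<longlonglongrightarrow> norm (v - p) ^ 2"
    by (intro tendsto_intros p)
  moreover have "(\<lambda>n. d\<^sup>2 + inverse (real (Suc n))) \<longlonglongrightarrow> d\<^sup>2 + 0"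
    by (intro tendsto_intros LIMSEQ_inverse_real_of_nat)
  ultimately have "norm (v - p) ^ 2 \<le> d\<^sup>2"
    using s(2) by (intro LIMSEQ_le) (auto intro: less_imp_le)
  then have "norm (v - p) \<le> d" using d0 power2_le_imp_le by blast
  then have min: "\<forall>z\<in>S. dist v p \<le> dist v z" using d_le by (force simp: dist_norm)
  have "(v - p) \<bullet> t = 0" if "t \<in> S" for t
  proof -
    \<comment> \<open>The variational inequality at these two points bounds the inner product with
      \<open>t\<close> by 0 from both sides.\<close>
    have "p + t \<in> S" "p - t \<in> S" using S(1) pS that by (auto simp: subspace_add subspace_diff)
    from this[THEN any_closest_point_dot[OF subspace_imp_convex[OF S(1)] S(2) pS _ min]]
    show ?thesis by simp
  qed
  with pS show ?thesis by (rule that)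
qed

text \<open>The residual \<open>v - p\<close> of the projection lies in the complement of
  \<open>S\<close>, so it is orthogonal both to \<open>v\<close> and to \<open>p\<close>, hence to
  itself.\<close>

lemma orthogonal_comp_orthogonal_comp_closed_subspace:
  fixes S :: "'a::{real_inner, banach} set"
  assumes "subspace S" "closed S"
  shows "orthogonal_comp (orthogonal_comp S) = S"
proof (rule antisym[OF _ orthogonal_comp_subset], rule subsetI)
  fix v assume v: "v \<in> orthogonal_comp (orthogonal_comp S)"
  obtain p where p: "p \<in> S" "\<And>s. s \<in> S \<Longrightarrow> (v - p) \<bullet> s = 0"
    using closed_subspace_orthogonal_projection[OF assms] by blast
  have "v - p \<in> orthogonal_comp S"
    using p(2) by (auto simp: orthogonal_comp_def orthogonal_def inner_commute)
  then have "(v - p) \<bullet> v = 0"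
    using v by (auto simp: orthogonal_comp_def orthogonal_def)
  with p have "(v - p) \<bullet> (v - p) = 0" by (simp add: inner_diff_right)
  then show "v \<in> S" using p(1) by simp
qed

subsection \<open>Orthonormal expansions\<close>

definition orthonormal_on :: "'i set \<Rightarrow> ('i \<Rightarrow> 'a::real_inner) \<Rightarrow> bool" where
  "orthonormal_on J e \<longleftrightarrow> (\<forall>i\<in>J. \<forall>j\<in>J. e i \<bullet> e j = (if i = j then 1 else 0))"

lemma norm_sum_orthonormal:
  assumes "orthonormal_on J e" "finite F" "F \<subseteq> J"
  shows "norm (\<Sum>j\<in>F. c j *\<^sub>R e j) ^ 2 = (\<Sum>j\<in>F. (c j)\<^sup>2)"
proof -
  have "norm (\<Sum>j\<in>F. c j *\<^sub>R e j) ^ 2 = (\<Sum>i\<in>F. \<Sum>j\<in>F. if i = j then c i * c j else 0)"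
    unfolding power2_norm_eq_inner inner_sum_left inner_sum_right
    using assms by (intro sum.cong refl) (auto simp: orthonormal_on_def subset_iff)
  also have "\<dots> = (\<Sum>j\<in>F. (c j)\<^sup>2)"
    using assms(2) by (simp add: power2_eq_square)
  finally show ?thesis .
qed

lemma bessel_finite:
  assumes "orthonormal_on J e" "finite F" "F \<subseteq> J"
  shows "(\<Sum>j\<in>F. (v \<bullet> e j)\<^sup>2) \<le> (norm v)\<^sup>2"
proof -
  let ?p = "\<Sum>j\<in>F. (v \<bullet> e j) *\<^sub>R e j"
  have "v \<bullet> ?p = (\<Sum>j\<in>F. (v \<bullet> e j)\<^sup>2)"
    by (simp add: inner_sum_right power2_eq_square)
  moreover have "norm ?p ^ 2 = (\<Sum>j\<in>F. (v \<bullet> e j)\<^sup>2)"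
    by (rule norm_sum_orthonormal[OF assms])
  moreover have "0 \<le> norm (v - ?p) ^ 2" by simp
  ultimately show ?thesis
    by (simp add: power2_norm_eq_inner inner_diff_left inner_diff_right inner_commute)
qed

lemma bessel_summable:
  assumes "orthonormal_on J e"
  shows "(\<lambda>j. (v \<bullet> e j)\<^sup>2) summable_on J"
  by (rule nonneg_bdd_above_summable_on)
    (auto intro!: bdd_aboveI[of _ "(norm v)\<^sup>2"] bessel_finite[OF assms])

lemma has_sum_scaleR_inner:
  assumes "((\<lambda>j. c j *\<^sub>R e j) has_sum s) J"
  shows "((\<lambda>j. c j * (e j \<bullet> w)) has_sum s \<bullet> w) J"
  using has_sum_bounded_linear[OF bounded_linear_inner_left[of w] assms] by (simp add: o_def)

lemma orthonormal_has_sum_coeff: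
  assumes "orthonormal_on J e" "((\<lambda>j. c j *\<^sub>R e j) has_sum s) J" "i \<in> J"
  shows "s \<bullet> e i = c i"
proof -
  have "((\<lambda>j. c j * (e j \<bullet> e i)) has_sum s \<bullet> e i) J"
    by (rule has_sum_scaleR_inner[OF assms(2)])
  moreover have "((\<lambda>j. c j * (e j \<bullet> e i)) has_sum c i) J"
    using assms(1,3) by (intro has_sum_finite_neutralI[of "{i}"]) (auto simp: orthonormal_on_def)
  ultimately show ?thesis by (rule has_sum_unique)
qed

lemma orthonormal_has_sum_norm:
  assumes "orthonormal_on J e" "((\<lambda>j. c j *\<^sub>R e j) has_sum s) J"
  shows "((\<lambda>j. (c j)\<^sup>2) has_sum (norm s)\<^sup>2) J"
proof -
  have "((\<lambda>j. c j * (e j \<bullet> s)) has_sum (norm s)\<^sup>2) J"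
    using has_sum_scaleR_inner[OF assms(2), of s] by (simp add: power2_norm_eq_inner)
  then show ?thesis
    by (rule has_sum_cong[THEN iffD1, rotated])
      (use orthonormal_has_sum_coeff[OF assms] in \<open>simp add: inner_commute power2_eq_square\<close>)
qed

text \<open>Riesz-Fischer: by Pythagoras the squared norm of the difference of two nested partial
  sums is a partial sum of the squared coefficients. The partial sums are therefore Cauchy along the
  finite subsets of \<open>J\<close>.\<close>

lemma orthonormal_summable:
  fixes e :: "'i \<Rightarrow> 'a::{real_inner, banach}"
  assumes on: "orthonormal_on J e" and c: "(\<lambda>j. (c j)\<^sup>2) summable_on J"
  shows "(\<lambda>j. c j *\<^sub>R e j) summable_on J"
proof -
  let ?f = "\<lambda>j. c j *\<^sub>R e j"
  obtain L where L: "((\<lambda>j. (c j)\<^sup>2) has_sum L) J" using c summable_on_def by blast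
  have "\<exists>P. eventually P (finite_subsets_at_top J) \<and> (\<forall>F F'. P F \<and> P F' \<longrightarrow> dist (sum ?f F) (sum ?f F') < \<epsilon>)"
    if \<epsilon>: "0 < \<epsilon>" for \<epsilon>
  proof -
    have "\<forall>\<^sub>F F in finite_subsets_at_top J. dist (\<Sum>j\<in>F. (c j)\<^sup>2) L < (\<epsilon> / 2)\<^sup>2"
      using L \<epsilon> unfolding has_sum_def by (intro tendstoD) auto
    then obtain X where X: "finite X" "X \<subseteq> J"
      "\<And>F. finite F \<Longrightarrow> X \<subseteq> F \<Longrightarrow> F \<subseteq> J \<Longrightarrow> dist (\<Sum>j\<in>F. (c j)\<^sup>2) L < (\<epsilon> / 2)\<^sup>2"
      by (auto simp: eventually_finite_subsets_at_top)
    \<comment> \<open>Partial sums of squares do not exceed \<open>L\<close>, so what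
      \<open>F\<close> adds to \<open>X\<close> is at most the gap between \<open>L\<close> and the
      sum over \<open>X\<close>.\<close>
    have close: "dist (sum ?f F) (sum ?f X) < \<epsilon> / 2" if F: "finite F" "X \<subseteq> F" "F \<subseteq> J" for F
    proof -
      have "sum (\<lambda>j. (c j)\<^sup>2) X \<le> L"
        by (rule finite_sum_le_has_sum[OF L X(1,2)]) simp
      moreover have "sum (\<lambda>j. (c j)\<^sup>2) F \<le> L"
        by (rule finite_sum_le_has_sum[OF L F(1,3)]) simp
      moreover have "dist (\<Sum>j\<in>X. (c j)\<^sup>2) L < (\<epsilon> / 2)\<^sup>2" using X by blast
      moreover have "(\<Sum>j\<in>F - X. (c j)\<^sup>2) = sum (\<lambda>j. (c j)\<^sup>2) F - sum (\<lambda>j. (c j)\<^sup>2) X"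
        by (rule sum_diff[OF F(1,2)])
      ultimately have "(\<Sum>j\<in>F - X. (c j)\<^sup>2) < (\<epsilon> / 2)\<^sup>2" by (simp add: dist_real_def)
      moreover have "norm (sum ?f (F - X)) ^ 2 = (\<Sum>j\<in>F - X. (c j)\<^sup>2)"
        using F by (intro norm_sum_orthonormal[OF on]) auto
      ultimately have "norm (sum ?f (F - X)) ^ 2 < (\<epsilon> / 2)\<^sup>2" by simp
      then have "norm (sum ?f (F - X)) < \<epsilon> / 2"
        by (rule power_less_imp_less_base) (use \<epsilon> in simp)
      then show ?thesis by (simp add: dist_norm sum_diff[OF F(1,2)])
    qed
    show ?thesis
    proof (intro exI conjI allI impI)
      show "eventually (\<lambda>F. finite F \<and> X \<subseteq> F \<and> F \<subseteq> J) (finite_subsets_at_top J)"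
        using X by (auto simp: eventually_finite_subsets_at_top)
    next
      fix F F'
      assume "(finite F \<and> X \<subseteq> F \<and> F \<subseteq> J) \<and> finite F' \<and> X \<subseteq> F' \<and> F' \<subseteq> J"
      then show "dist (sum ?f F) (sum ?f F') < \<epsilon>"
        using dist_triangle_half_l[OF close[of F] close[of F']] by blast
    qed
  qed
  then have "cauchy_filter (filtermap (sum ?f) (finite_subsets_at_top J))"
    unfolding cauchy_filter_metric_filtermap by blast
  moreover have "complete (UNIV :: 'a set)"
    by (meson Cauchy_convergent UNIV_I complete_def convergent_def)
  ultimately obtain s where "(sum ?f \<longlongrightarrow> s) (finite_subsets_at_top J)"
    using complete_uniform[where S = "UNIV :: 'a set"] by (force simp: filterlim_def)
  then show ?thesis using summable_on_def has_sum_def by blast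
qed

lemma orthonormal_multiplier_square_summable:
  assumes "orthonormal_on J e" "\<And>j. j \<in> J \<Longrightarrow> \<bar>b j\<bar> \<le> C"
  shows "(\<lambda>j. (b j * (v \<bullet> e j))\<^sup>2) summable_on J"
proof (rule summable_on_comparison_test)
  show "(\<lambda>j. C\<^sup>2 * (v \<bullet> e j)\<^sup>2) summable_on J"
    by (intro summable_on_cmult_right bessel_summable assms)
  show "(b j * (v \<bullet> e j))\<^sup>2 \<le> C\<^sup>2 * (v \<bullet> e j)\<^sup>2" if "j \<in> J" for j
    using power_mono[OF assms(2)[OF that] abs_ge_zero, of 2]
    by (simp add: power_mult_distrib mult_right_mono)
qed auto

lemma orthonormal_multiplier_summable:
  fixes f :: "'i \<Rightarrow> 'a::{real_inner, banach}"
  assumes "orthonormal_on J e" "orthonormal_on J f" "\<And>j. j \<in> J \<Longrightarrow> \<bar>b j\<bar> \<le> C"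
  shows "(\<lambda>j. (b j * (v \<bullet> e j)) *\<^sub>R f j) summable_on J"
  by (rule orthonormal_summable[OF assms(2) orthonormal_multiplier_square_summable[OF assms(1,3)]])

text \<open>Comparison of coefficients, followed by Bessel. Two systems are allowed, since the
  estimate is applied both within the domain of \<open>K\<close> and to the reconstruction, which
  maps \<open>y\<close>-coefficients to \<open>x\<close>-coefficients.\<close>

lemma orthonormal_multiplier_norm_le:
  assumes "orthonormal_on J e" "orthonormal_on J f" "\<And>j. j \<in> J \<Longrightarrow> \<bar>b j\<bar> \<le> C" "0 \<le> C"
    and "((\<lambda>j. (b j * (v \<bullet> e j)) *\<^sub>R f j) has_sum s) J"
  shows "norm s \<le> C * norm v"
proof -
  have hs: "((\<lambda>j. (b j * (v \<bullet> e j))\<^sup>2) has_sum (norm s)\<^sup>2) J"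
    by (rule orthonormal_has_sum_norm[OF assms(2,5)])
  have "(norm s)\<^sup>2 \<le> (C * norm v)\<^sup>2"
  proof (rule has_sum_le_finite_sums[OF hs])
    fix F assume F: "finite F" "F \<subseteq> J"
    have "(\<Sum>j\<in>F. (b j * (v \<bullet> e j))\<^sup>2) \<le> (\<Sum>j\<in>F. C\<^sup>2 * (v \<bullet> e j)\<^sup>2)"
    proof (rule sum_mono)
      fix j assume "j \<in> F"
      then have "\<bar>b j\<bar> \<le> C" using F assms(3) by blast
      from power_mono[OF this abs_ge_zero, of 2]
      show "(b j * (v \<bullet> e j))\<^sup>2 \<le> C\<^sup>2 * (v \<bullet> e j)\<^sup>2"
        by (simp add: power_mult_distrib mult_right_mono)
    qed
    also have "\<dots> \<le> (C * norm v)\<^sup>2"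
      using bessel_finite[OF assms(1) F, of v]
      by (simp add: power_mult_distrib mult_left_mono flip: sum_distrib_left)
    finally show "(\<Sum>j\<in>F. (b j * (v \<bullet> e j))\<^sup>2) \<le> (C * norm v)\<^sup>2" .
  qed
  then show ?thesis by (rule power2_le_imp_le) (use assms(4) in simp)
qed

subsection \<open>Functions of the normal operator\<close>

text \<open>The image of the unit ball has compact closure and is thus bounded; homogeneity extends
  the bound to all vectors.\<close>

lemma compact_operator_bounded_linear:
  assumes "compact_operator K"
  shows "bounded_linear K"
proof -
  have lin: "linear K" and "compact (closure (K ` cball 0 1))"
    using assms by (auto simp: compact_operator_def)
  then have "bounded (K ` cball 0 1)"
    by (intro bounded_subset[OF compact_imp_bounded closure_subset])
  then obtain B where "\<forall>w\<in>K ` cball 0 1. norm w \<le> B"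
    unfolding bounded_iff by blast
  then have B: "norm (K v) \<le> B" if "norm v \<le> 1" for v
    using that by simp
  have "norm (K v) \<le> norm v * B" for v
  proof (cases "v = 0")
    case False
    have "norm (K ((1 / norm v) *\<^sub>R v)) \<le> B" by (rule B) (use False in simp)
    then show ?thesis using False by (simp add: linear_scale[OF lin] divide_simps mult.commute)
  qed (simp add: linear_0[OF lin])
  then show ?thesis
    using lin by (intro bounded_linear_intro) (auto simp: linear_add linear_scale)
qed

text \<open>Stone-Weierstrass with tolerance \<open>1 / (n + 1)\<close>, rewritten in the type of
  polynomials that \<open>functional_calculus\<close> quantifies over.\<close>

lemma poly_approximation:
  fixes f :: "real \<Rightarrow> real"
  assumes "continuous_on {a..b} f"
  obtains p where "uniform_limit {a..b} (\<lambda>n. poly (p n)) f sequentially"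
proof -
  have "\<exists>p. \<forall>t\<in>{a..b}. \<bar>poly p t - f t\<bar> < inverse (real (Suc n))" for n
  proof -
    obtain g where g: "real_polynomial_function g"
      "\<And>t. t \<in> {a..b} \<Longrightarrow> \<bar>f t - g t\<bar> < inverse (real (Suc n))"
      using Stone_Weierstrass_real_polynomial_function[OF compact_Icc assms, of "inverse (real (Suc n))"]
      by auto
    from g(1) obtain c N where "g = (\<lambda>t. \<Sum>i\<le>N. c i * t ^ i)"
      unfolding real_polynomial_function_iff_sum by blast
    then have "poly (\<Sum>i\<le>N. monom (c i) i) t = g t" for t
      by (simp add: poly_sum poly_monom)
    then show ?thesis using g(2) by (intro exI[of _ "\<Sum>i\<le>N. monom (c i) i"]) (simp add: abs_minus_commute)
  qed
  then obtain p where p: "\<And>n t. t \<in> {a..b} \<Longrightarrow> \<bar>poly (p n) t - f t\<bar> < inverse (real (Suc n))"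
    by metis
  have "uniform_limit {a..b} (\<lambda>n. poly (p n)) f sequentially"
  proof (rule uniform_limitI)
    fix e :: real assume "0 < e"
    then obtain N where N: "inverse (real (Suc N)) < e" using reals_Archimedean by blast
    have "inverse (real (Suc n)) < e" if "n \<ge> N" for n
    proof -
      have "inverse (real (Suc n)) \<le> inverse (real (Suc N))"
        using that by (intro le_imp_inverse_le) auto
      with N show ?thesis by linarith
    qed
    then show "\<forall>\<^sub>F n in sequentially. \<forall>t\<in>{a..b}. dist (poly (p n) t) (f t) < e"
      unfolding eventually_sequentially dist_real_def by (meson p less_trans)
  qed
  then show ?thesis by (rule that)
qed

section \<open>Singular systems, the kernel of \<open>K\<close> and coordinates\<close>

locale compact_singular_system =
  fixes K :: "'a::{real_inner, banach} \<Rightarrow> 'b::{real_inner, banach}"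
    and J :: "nat set" and \<mu> :: "nat \<Rightarrow> real" and x :: "nat \<Rightarrow> 'a" and y :: "nat \<Rightarrow> 'b"
  assumes compact: "compact_operator K"
    and nonzero: "K \<noteq> (\<lambda>_. 0)"
    and system: "singular_system K J \<mu> x y"
begin

lemma K_bounded_linear: "bounded_linear K"
  by (rule compact_operator_bounded_linear[OF compact])

lemma orthonormal_x: "orthonormal_on J x" and orthonormal_y: "orthonormal_on J y"
  using system by (auto simp: singular_system_def orthonormal_on_def)

lemma \<mu>_pos: "j \<in> J \<Longrightarrow> 0 < \<mu> j"
  using system by (auto simp: singular_system_def)

lemma K_x: "j \<in> J \<Longrightarrow> K (x j) = \<mu> j *\<^sub>R y j"
  using system by (auto simp: singular_system_def)

text \<open>Completeness of the \<open>x\<close>-system in use: a vector orthogonal to all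
  \<open>x j\<close> lies in the double orthogonal complement of the kernel, which is the kernel
  itself because that is a closed subspace.\<close>

lemma K_eq_0_iff: "K v = 0 \<longleftrightarrow> (\<forall>j\<in>J. v \<bullet> x j = 0)"
proof
  have cl: "closure (span (x ` J)) = orthogonal_comp {v. K v = 0}"
    using system by (simp add: singular_system_def)
  show "\<forall>j\<in>J. v \<bullet> x j = 0" if "K v = 0"
  proof
    fix j assume "j \<in> J"
    then have "x j \<in> closure (span (x ` J))"
      by (meson closure_subset image_eqI span_base subset_iff)
    then show "v \<bullet> x j = 0"
      using that unfolding cl by (simp add: orthogonal_comp_def orthogonal_def)
  qed
  assume v: "\<forall>j\<in>J. v \<bullet> x j = 0"
  have "span (x ` J) \<subseteq> {u. v \<bullet> u = 0}"
    using v by (intro span_minimal) (auto simp: subspace_def inner_add_right)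
  then have "closure (span (x ` J)) \<subseteq> {u. v \<bullet> u = 0}"
    by (rule closure_minimal) (rule closed_hyperplane)
  then have "v \<in> orthogonal_comp (orthogonal_comp {v. K v = 0})"
    unfolding cl by (auto simp: orthogonal_comp_def orthogonal_def inner_commute)
  moreover have "subspace {v. K v = 0}"
    using K_bounded_linear bounded_linear.linear linear_subspace_kernel by blast
  moreover have "closed {v. K v = 0}"
    using bounded_linear.continuous_on[OF K_bounded_linear continuous_on_id]
    by (intro closed_Collect_eq continuous_on_const) auto
  ultimately show "K v = 0"
    using orthogonal_comp_orthogonal_comp_closed_subspace by blast
qed

lemma one_in_J: "1 \<in> J"
proof -
  \<comment> \<open>For empty \<open>J\<close> the criterion \<open>K_eq_0_iff\<close> would hold
    vacuously for every vector.\<close>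
  have "J \<noteq> {}" using nonzero K_eq_0_iff by auto
  then show ?thesis using system by (auto simp: singular_system_def)
qed

lemma \<mu>_le: "j \<in> J \<Longrightarrow> \<mu> j \<le> \<mu> 1"
  using system one_in_J unfolding singular_system_def
  by (metis atLeastAtMost_iff atLeast_iff)

lemma \<mu>_sq_le: "j \<in> J \<Longrightarrow> (\<mu> j)\<^sup>2 \<le> (\<mu> 1)\<^sup>2"
  using \<mu>_le \<mu>_pos by (simp add: power_mono less_imp_le)

lemma x_inner: "i \<in> J \<Longrightarrow> j \<in> J \<Longrightarrow> x i \<bullet> x j = (if i = j then 1 else 0)"
  using orthonormal_x by (auto simp: orthonormal_on_def)

lemma x_nonzero: "j \<in> J \<Longrightarrow> x j \<noteq> 0"
  using x_inner[of j j] by auto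

text \<open>The set of eigenvalues of K*K rather than its spectrum: 0 belongs to it only if
  \<open>K\<close> has a nontrivial kernel, even when 0 is a limit of the squared singular
  values.\<close>

definition spec :: "real set" where
  "spec = (\<lambda>j. (\<mu> j)\<^sup>2) ` J \<union> {t. t = 0 \<and> (\<exists>v. v \<noteq> 0 \<and> K v = 0)}"

lemma \<mu>_in_spec: "j \<in> J \<Longrightarrow> (\<mu> j)\<^sup>2 \<in> spec"
  by (simp add: spec_def)

lemma spec_subset: "spec \<subseteq> {0..(\<mu> 1)\<^sup>2}"
  using \<mu>_sq_le by (auto simp: spec_def)

text \<open>This is the orthogonal projection onto the kernel of \<open>K\<close>, obtained as the
  remainder of the expansion in the \<open>x\<close>-system.\<close>

definition null_part :: "'a \<Rightarrow> 'a" where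
  "null_part v = v - (\<Sum>\<^sub>\<infinity>j\<in>J. (v \<bullet> x j) *\<^sub>R x j)"

lemma has_sum_null_part: "((\<lambda>j. (v \<bullet> x j) *\<^sub>R x j) has_sum (v - null_part v)) J"
  using orthonormal_multiplier_summable[OF orthonormal_x orthonormal_x, of "\<lambda>_. 1" 1 v]
  by (simp add: null_part_def)

lemma null_part_inner: "j \<in> J \<Longrightarrow> null_part v \<bullet> x j = 0"
  using orthonormal_has_sum_coeff[OF orthonormal_x has_sum_null_part, of j v]
  by (simp add: inner_diff_left)

lemma K_null_part: "K (null_part v) = 0"
  by (simp add: K_eq_0_iff null_part_inner)

lemma null_part_eq_0: "0 \<notin> spec \<Longrightarrow> null_part v = 0"
  using K_null_part by (auto simp: spec_def)

text \<open>The vector \<open>n\<close> does not change the \<open>x\<close>-coefficients, so the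
  expansion of \<open>s + n\<close> is that of \<open>s\<close>. The algebraic rules for
  \<open>null_part\<close> follow from this.\<close>

lemma null_part_eqI:
  assumes "((\<lambda>j. c j *\<^sub>R x j) has_sum s) J" "\<And>j. j \<in> J \<Longrightarrow> n \<bullet> x j = 0"
  shows "null_part (s + n) = n"
proof -
  have "((\<lambda>j. ((s + n) \<bullet> x j) *\<^sub>R x j) has_sum s) J"
    by (rule has_sum_cong[THEN iffD1, OF _ assms(1)])
      (simp add: inner_add_left assms(2) orthonormal_has_sum_coeff[OF orthonormal_x assms(1)])
  then show ?thesis by (simp add: null_part_def infsumI)
qed

lemma null_part_has_sum: "((\<lambda>j. c j *\<^sub>R x j) has_sum s) J \<Longrightarrow> null_part s = 0"
  using null_part_eqI[of c s 0] by simp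

lemma null_part_add: "null_part (u + v) = null_part u + null_part v"
proof -
  have "((\<lambda>j. (u \<bullet> x j + v \<bullet> x j) *\<^sub>R x j) has_sum (u - null_part u) + (v - null_part v)) J"
    using has_sum_add[OF has_sum_null_part[of u] has_sum_null_part[of v]]
    by (simp add: scaleR_add_left)
  from null_part_eqI[OF this, of "null_part u + null_part v"] show ?thesis
    by (simp add: inner_add_left null_part_inner)
qed

lemma null_part_scaleR: "null_part (c *\<^sub>R v) = c *\<^sub>R null_part v"
proof -
  have "((\<lambda>j. (c * (v \<bullet> x j)) *\<^sub>R x j) has_sum c *\<^sub>R (v - null_part v)) J"
    using has_sum_bounded_linear[OF bounded_linear_scaleR_right has_sum_null_part]
    by (simp add: o_def)
  from null_part_eqI[OF this, of "c *\<^sub>R null_part v"] show ?thesis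
    by (simp add: null_part_inner algebra_simps)
qed

lemma null_part_x: "j \<in> J \<Longrightarrow> null_part (x j) = 0"
  by (rule null_part_has_sum[of "\<lambda>i. if i = j then 1 else 0"], rule has_sum_finite_neutralI[of "{j}"])
    auto

text \<open>This reduces equations between vectors, and with \<open>spectral_op_eqI\<close> between
  operators, to scalar equations for each singular value and one on the kernel.\<close>

lemma eq_by_coordinates:
  assumes "\<And>j. j \<in> J \<Longrightarrow> u \<bullet> x j = v \<bullet> x j" "null_part u = null_part v"
  shows "u = v"
proof -
  have "(\<Sum>\<^sub>\<infinity>j\<in>J. (u \<bullet> x j) *\<^sub>R x j) = (\<Sum>\<^sub>\<infinity>j\<in>J. (v \<bullet> x j) *\<^sub>R x j)"
    by (rule infsum_cong) (simp add: assms(1))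
  with assms(2) show ?thesis by (simp add: null_part_def)
qed

text \<open>\<open>h(K\<^sup>*K)\<close>. The value \<open>h 0\<close> is only relevant if \<open>K\<close> has a kernel, that is, if \<open>0 \<in> spec\<close>.\<close>

definition spectral_op :: "(real \<Rightarrow> real) \<Rightarrow> 'a \<Rightarrow> 'a" where
  "spectral_op h v = (\<Sum>\<^sub>\<infinity>j\<in>J. (h ((\<mu> j)\<^sup>2) * (v \<bullet> x j)) *\<^sub>R x j) + h 0 *\<^sub>R null_part v"

lemma bounded_on_spec:
  fixes h :: "real \<Rightarrow> real"
  assumes "bounded (h ` spec)"
  obtains C where "0 \<le> C" "\<And>t. t \<in> spec \<Longrightarrow> \<bar>h t\<bar> \<le> C"
proof -
  obtain C where "\<forall>w\<in>h ` spec. norm w \<le> C" using assms unfolding bounded_iff by blast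
  then have "\<bar>h t\<bar> \<le> max 0 C" if "t \<in> spec" for t using that by (simp add: le_max_iff_disj)
  then show thesis by (rule that[rotated]) simp_all
qed

lemma spectral_op_has_sum:
  assumes "bounded (h ` spec)"
  shows "((\<lambda>j. (h ((\<mu> j)\<^sup>2) * (v \<bullet> x j)) *\<^sub>R x j) has_sum
    (spectral_op h v - h 0 *\<^sub>R null_part v)) J"
proof -
  obtain C where C: "\<And>t. t \<in> spec \<Longrightarrow> \<bar>h t\<bar> \<le> C" using bounded_on_spec[OF assms] by blast
  have "(\<lambda>j. (h ((\<mu> j)\<^sup>2) * (v \<bullet> x j)) *\<^sub>R x j) summable_on J"
    by (rule orthonormal_multiplier_summable[OF orthonormal_x orthonormal_x])
      (rule C[OF \<mu>_in_spec])
  then show ?thesis by (simp add: spectral_op_def)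
qed

lemma spectral_op_inner:
  assumes "bounded (h ` spec)" "j \<in> J"
  shows "spectral_op h v \<bullet> x j = h ((\<mu> j)\<^sup>2) * (v \<bullet> x j)"
  using orthonormal_has_sum_coeff[OF orthonormal_x spectral_op_has_sum[OF assms(1)] assms(2), of v]
  by (simp add: inner_diff_left null_part_inner assms(2))

lemma spectral_op_null_part:
  assumes "bounded (h ` spec)"
  shows "null_part (spectral_op h v) = h 0 *\<^sub>R null_part v"
  using null_part_eqI[OF spectral_op_has_sum[OF assms], of "h 0 *\<^sub>R null_part v" v]
  by (simp add: null_part_inner)

lemma spectral_op_eqI:
  assumes "bounded (h ` spec)" "\<And>j. j \<in> J \<Longrightarrow> u \<bullet> x j = h ((\<mu> j)\<^sup>2) * (v \<bullet> x j)"
    and "null_part u = h 0 *\<^sub>R null_part v"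
  shows "u = spectral_op h v"
  by (rule eq_by_coordinates) (simp_all add: spectral_op_inner spectral_op_null_part assms)

lemma bounded_spec_const: "bounded ((\<lambda>_. c) ` spec)"
  by (rule bounded_subset[of "{c}"]) auto

lemma bounded_spec_id: "bounded ((\<lambda>t. t) ` spec)"
  using bounded_subset[OF _ spec_subset] by simp

lemma bounded_spec_add:
  fixes g h :: "real \<Rightarrow> real"
  assumes "bounded (g ` spec)" "bounded (h ` spec)"
  shows "bounded ((\<lambda>t. g t + h t) ` spec)"
  by (rule bounded_plus_comp[OF assms])

lemma bounded_spec_mult:
  fixes g h :: "real \<Rightarrow> real"
  assumes "bounded (g ` spec)" "bounded (h ` spec)"
  shows "bounded ((\<lambda>t. g t * h t) ` spec)"
proof -
  obtain B C where "0 \<le> B" "0 \<le> C" "\<And>t. t \<in> spec \<Longrightarrow> \<bar>g t\<bar> \<le> B" "\<And>t. t \<in> spec \<Longrightarrow> \<bar>h t\<bar> \<le> C"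
    using bounded_on_spec assms by metis
  then have "norm (g t * h t) \<le> B * C" if "t \<in> spec" for t
    using that by (simp add: abs_mult mult_mono)
  then show ?thesis by (auto simp: bounded_iff)
qed

lemma bounded_spec_continuous:
  fixes h :: "real \<Rightarrow> real"
  assumes "continuous_on {0..(\<mu> 1)\<^sup>2} h"
  shows "bounded (h ` spec)"
  by (meson assms bounded_subset compact_Icc compact_continuous_image compact_imp_bounded
      image_mono spec_subset)

lemma spectral_op_add:
  assumes "bounded (g ` spec)" "bounded (h ` spec)"
  shows "spectral_op g v + spectral_op h v = spectral_op (\<lambda>t. g t + h t) v"
  by (rule spectral_op_eqI)
    (simp_all add: assms bounded_spec_add spectral_op_inner spectral_op_null_part null_part_add
      inner_add_left algebra_simps)

lemma spectral_op_mult: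
  assumes "bounded (g ` spec)" "bounded (h ` spec)"
  shows "spectral_op g (spectral_op h v) = spectral_op (\<lambda>t. g t * h t) v"
  by (rule spectral_op_eqI)
    (simp_all add: assms bounded_spec_mult spectral_op_inner spectral_op_null_part)

lemma spectral_op_const: "spectral_op (\<lambda>_. c) v = c *\<^sub>R v"
  by (rule sym, rule spectral_op_eqI) (simp_all add: bounded_spec_const null_part_scaleR)

lemma spectral_op_scaleR:
  assumes "bounded (h ` spec)"
  shows "c *\<^sub>R spectral_op h v = spectral_op (\<lambda>t. c * h t) v"
  using spectral_op_mult[OF bounded_spec_const assms, of c v] by (simp add: spectral_op_const)

lemma spectral_op_diff:
  assumes "bounded (g ` spec)" "bounded (h ` spec)"
  shows "spectral_op g v - spectral_op h v = spectral_op (\<lambda>t. g t - h t) v"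
  using spectral_op_add[OF assms(1) bounded_spec_mult[OF bounded_spec_const assms(2)], of v "-1"]
    spectral_op_scaleR[OF assms(2), of "-1" v, symmetric] by simp

text \<open>The operator respects the splitting into the kernel and its complement, so the bound is
  proved on each summand and recombined by Pythagoras.\<close>

lemma spectral_op_norm_le:
  assumes "0 \<le> C" "\<And>t. t \<in> spec \<Longrightarrow> \<bar>h t\<bar> \<le> C"
  shows "norm (spectral_op h v) \<le> C * norm v"
proof -
  have bdd: "bounded (h ` spec)" using assms(2) by (auto simp: bounded_iff)
  define n where "n = null_part v"
  define s where "s = spectral_op h v - h 0 *\<^sub>R n"
  have hs: "((\<lambda>j. (h ((\<mu> j)\<^sup>2) * (v \<bullet> x j)) *\<^sub>R x j) has_sum s) J"
    unfolding s_def n_def by (rule spectral_op_has_sum[OF bdd])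
  have n: "j \<in> J \<Longrightarrow> n \<bullet> x j = 0" for j by (simp add: n_def null_part_inner)
  have orth: "w \<bullet> n = 0" if "((\<lambda>j. c j *\<^sub>R x j) has_sum w) J" for c w
    by (rule has_sum_unique[OF has_sum_scaleR_inner[OF that, of n]])
      (rule has_sum_0, simp add: n inner_commute)
  have pyth: "(norm (w + b *\<^sub>R n))\<^sup>2 = (norm w)\<^sup>2 + b\<^sup>2 * (norm n)\<^sup>2" if "w \<bullet> n = 0" for w b
    using that by (simp add: power2_norm_eq_inner inner_add_left inner_add_right inner_commute)
      (simp add: power2_eq_square)
  have "norm s \<le> C * norm (v - n)"
  proof (rule orthonormal_multiplier_norm_le[OF orthonormal_x orthonormal_x _ assms(1)])
    show "((\<lambda>j. (h ((\<mu> j)\<^sup>2) * ((v - n) \<bullet> x j)) *\<^sub>R x j) has_sum s) J"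
      by (rule has_sum_cong[THEN iffD1, OF _ hs]) (simp add: inner_diff_left n)
  qed (rule assms(2)[OF \<mu>_in_spec])
  from power_mono[OF this norm_ge_zero, of 2] have "(norm s)\<^sup>2 \<le> C\<^sup>2 * (norm (v - n))\<^sup>2"
    by (simp add: power_mult_distrib)
  \<comment> \<open>If 0 is not in \<open>spec\<close>, the hypothesis says nothing about
    \<open>h 0\<close>, but then the kernel component \<open>n\<close> vanishes.\<close>
  moreover have "(h 0)\<^sup>2 * (norm n)\<^sup>2 \<le> C\<^sup>2 * (norm n)\<^sup>2"
  proof (cases "0 \<in> spec")
    case True
    then show ?thesis
      using power_mono[OF assms(2)[OF True] abs_ge_zero, of 2] by (simp add: mult_right_mono)
  qed (simp add: n_def null_part_eq_0)
  moreover have "(norm (spectral_op h v))\<^sup>2 = (norm s)\<^sup>2 + (h 0)\<^sup>2 * (norm n)\<^sup>2"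
    using pyth[OF orth[OF hs], of "h 0"] by (simp add: s_def)
  moreover have "(norm v)\<^sup>2 = (norm (v - n))\<^sup>2 + (norm n)\<^sup>2"
    using pyth[OF orth[OF has_sum_null_part[of v, folded n_def]], of 1] by simp
  ultimately have "(norm (spectral_op h v))\<^sup>2 \<le> (C * norm v)\<^sup>2"
    by (simp add: power_mult_distrib algebra_simps)
  then show ?thesis by (rule power2_le_imp_le) (simp add: assms(1))
qed

lemma spectral_op_bounded_linear:
  assumes "bounded (h ` spec)"
  shows "bounded_linear (spectral_op h)"
proof -
  obtain C where C: "0 \<le> C" "\<And>t. t \<in> spec \<Longrightarrow> \<bar>h t\<bar> \<le> C" using bounded_on_spec[OF assms] by blast
  show ?thesis
  proof (rule bounded_linear_intro)
    show "spectral_op h (u + v) = spectral_op h u + spectral_op h v" for u v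
      by (rule sym, rule spectral_op_eqI)
        (simp_all add: assms spectral_op_inner spectral_op_null_part null_part_add
          inner_add_left algebra_simps)
    show "spectral_op h (c *\<^sub>R v) = c *\<^sub>R spectral_op h v" for c v
      by (rule sym, rule spectral_op_eqI)
        (simp_all add: assms spectral_op_inner spectral_op_null_part null_part_scaleR)
    show "norm (spectral_op h v) \<le> norm v * C" for v
      using spectral_op_norm_le[OF C] by (simp add: mult.commute)
  qed
qed

lemma spectral_op_onorm_le:
  assumes "0 \<le> C" "\<And>t. t \<in> spec \<Longrightarrow> \<bar>h t\<bar> \<le> C"
  shows "onorm (spectral_op h) \<le> C"
  by (rule onorm_bound[OF assms(1) spectral_op_norm_le[OF assms]])

text \<open>Every point of \<open>spec\<close> has an eigenvector, some \<open>x j\<close> or a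
  kernel vector, on which the operator acts as multiplication by \<open>h t\<close>. Together with
  the upper estimate, the operator norm is the supremum of the absolute value of \<open>h\<close> on
  \<open>spec\<close>.\<close>

lemma spectral_op_onorm_ge:
  assumes "bounded (h ` spec)" "t \<in> spec"
  shows "\<bar>h t\<bar> \<le> onorm (spectral_op h)"
proof -
  have "\<exists>v. v \<noteq> 0 \<and> spectral_op h v = h t *\<^sub>R v"
  proof (cases "\<exists>j\<in>J. t = (\<mu> j)\<^sup>2")
    case True
    then obtain j where j: "j \<in> J" "t = (\<mu> j)\<^sup>2" by blast
    have "h t *\<^sub>R x j = spectral_op h (x j)"
      by (rule spectral_op_eqI) (use j in \<open>auto simp: assms(1) null_part_scaleR null_part_x x_inner\<close>)
    then show ?thesis using x_nonzero[OF j(1)] by metis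
  next
    case False
    then obtain v where v: "t = 0" "v \<noteq> 0" "K v = 0" using assms(2) by (auto simp: spec_def)
    have "h t *\<^sub>R v = spectral_op h v"
      by (rule spectral_op_eqI) (use v K_eq_0_iff in \<open>auto simp: assms(1) null_part_scaleR\<close>)
    then show ?thesis using v(2) by metis
  qed
  then obtain v where v: "v \<noteq> 0" "spectral_op h v = h t *\<^sub>R v" by blast
  have "\<bar>h t\<bar> * norm v \<le> onorm (spectral_op h) * norm v"
    using onorm[OF spectral_op_bounded_linear[OF assms(1)], of v] v(2) by simp
  then show ?thesis using v(1) by simp
qed

section \<open>Polynomials in \<open>spectral_op h\<close> and the continuous functional
  calculus\<close>

lemma bounded_spec_power:
  fixes h :: "real \<Rightarrow> real"
  assumes "bounded (h ` spec)"
  shows "bounded ((\<lambda>t. h t ^ i) ` spec)"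
  by (induction i) (simp_all add: bounded_spec_const bounded_spec_mult assms)

lemma spectral_op_power:
  assumes "bounded (h ` spec)"
  shows "(spectral_op h ^^ i) v = spectral_op (\<lambda>t. h t ^ i) v"
  by (induction i)
    (simp_all add: spectral_op_const spectral_op_mult[OF assms bounded_spec_power[OF assms]])

lemma bounded_spec_sum:
  fixes g :: "'i \<Rightarrow> real \<Rightarrow> real"
  assumes "\<And>i. i \<in> F \<Longrightarrow> bounded (g i ` spec)"
  shows "bounded ((\<lambda>t. \<Sum>i\<in>F. g i t) ` spec)"
  using assms by (induction F rule: infinite_finite_induct)
    (simp_all add: bounded_spec_const bounded_spec_add)

lemma spectral_op_sum:
  assumes "finite F" "\<And>i. i \<in> F \<Longrightarrow> bounded (g i ` spec)"
  shows "(\<Sum>i\<in>F. spectral_op (g i) v) = spectral_op (\<lambda>t. \<Sum>i\<in>F. g i t) v"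
  using assms
proof (induction F rule: finite_induct)
  case empty
  then show ?case by (simp add: spectral_op_const)
next
  case (insert a F)
  then show ?case by (simp add: spectral_op_add bounded_spec_sum)
qed

lemma bounded_spec_poly:
  fixes h :: "real \<Rightarrow> real"
  assumes "bounded (h ` spec)"
  shows "bounded ((\<lambda>t. poly p (h t)) ` spec)"
  unfolding poly_altdef
  by (rule bounded_spec_sum, rule bounded_spec_mult[OF bounded_spec_const bounded_spec_power[OF assms]])

lemma poly_operator_spectral_op:
  assumes "bounded (h ` spec)"
  shows "poly_operator p (spectral_op h) = spectral_op (\<lambda>t. poly p (h t))"
  unfolding poly_operator_def poly_altdef
  by (simp add: fun_eq_iff spectral_op_power spectral_op_scaleR spectral_op_sum assms
      bounded_spec_mult bounded_spec_const bounded_spec_power)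

text \<open>For nonnegative symbols, the values of \<open>h\<close> stay in the interval on which
  \<open>functional_calculus\<close> asks for uniform approximation.\<close>

lemma spectral_op_range:
  assumes "bounded (h ` spec)" "\<And>t. t \<in> spec \<Longrightarrow> 0 \<le> h t"
  shows "h ` spec \<subseteq> {0..onorm (spectral_op h)}"
  using spectral_op_onorm_ge[OF assms(1)] assms(2) by fastforce

lemma bounded_spec_compose:
  fixes f :: "real \<Rightarrow> real"
  assumes "bounded (h ` spec)" "\<And>t. t \<in> spec \<Longrightarrow> 0 \<le> h t"
    and "continuous_on {0..onorm (spectral_op h)} f"
  shows "bounded ((\<lambda>t. f (h t)) ` spec)"
proof -
  have "bounded (f ` {0..onorm (spectral_op h)})"
    by (intro compact_imp_bounded compact_continuous_image assms(3) compact_Icc)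
  then have "bounded (f ` h ` spec)"
    by (rule bounded_subset) (intro image_mono spectral_op_range assms(1,2))
  then show ?thesis by (simp add: image_image)
qed

text \<open>The operator norm of the approximation error is at most the uniform error of the
  polynomials on the values of \<open>h\<close>. Weierstrass supplies an approximating sequence, and
  uniqueness of limits makes the \<open>THE\<close> in the definition well determined.\<close>

lemma functional_calculus_spectral_op:
  assumes h: "bounded (h ` spec)" "\<And>t. t \<in> spec \<Longrightarrow> 0 \<le> h t"
    and f: "continuous_on {0..onorm (spectral_op h)} f"
  shows "functional_calculus (spectral_op h) f = spectral_op (\<lambda>t. f (h t))"
proof -
  let ?A = "spectral_op h" and ?B = "spectral_op (\<lambda>t. f (h t))"
  have fh: "bounded ((\<lambda>t. f (h t)) ` spec)" by (rule bounded_spec_compose[OF assms])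
  \<comment> \<open>This is stated for every approximating sequence \<open>p\<close>, because the
    uniqueness part applies it to the sequence that comes with a competitor
    \<open>B\<close>.\<close>
  have lim: "(\<lambda>n. onorm (\<lambda>v. poly_operator (p n) ?A v - ?B v)) \<longlonglongrightarrow> 0"
    if "uniform_limit {0..onorm ?A} (\<lambda>n. poly (p n)) f sequentially" for p
  proof -
    have diff: "(\<lambda>v. poly_operator (p n) ?A v - ?B v) = spectral_op (\<lambda>t. poly (p n) (h t) - f (h t))" for n
      by (simp add: fun_eq_iff poly_operator_spectral_op h(1) spectral_op_diff bounded_spec_poly fh)
    have bdd: "bounded ((\<lambda>t. poly (p n) (h t) - f (h t)) ` spec)" for n
      by (rule bounded_minus_comp[OF bounded_spec_poly[OF h(1)] fh])
    show ?thesis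
    proof (rule LIMSEQ_I)
      fix e :: real assume e: "0 < e"
      have "\<forall>\<^sub>F n in sequentially. \<forall>t\<in>{0..onorm ?A}. dist (poly (p n) t) (f t) < e / 2"
        using uniform_limitD[OF that, of "e / 2"] e by simp
      then obtain N where N: "\<And>n t. n \<ge> N \<Longrightarrow> t \<in> {0..onorm ?A} \<Longrightarrow> dist (poly (p n) t) (f t) < e / 2"
        unfolding eventually_sequentially by blast
      have "norm (onorm (spectral_op (\<lambda>t. poly (p n) (h t) - f (h t)))) < e" if "n \<ge> N" for n
      proof -
        have "onorm (spectral_op (\<lambda>t. poly (p n) (h t) - f (h t))) \<le> e / 2"
        proof (rule spectral_op_onorm_le)
          fix t assume "t \<in> spec"
          then have "h t \<in> {0..onorm ?A}" using spectral_op_range[OF h] by blast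
          then show "\<bar>poly (p n) (h t) - f (h t)\<bar> \<le> e / 2"
            using N[OF that] by (simp add: dist_real_def less_imp_le)
        qed (use e in simp)
        moreover have "0 \<le> onorm (spectral_op (\<lambda>t. poly (p n) (h t) - f (h t)))"
          by (rule onorm_pos_le[OF spectral_op_bounded_linear[OF bdd]])
        ultimately show ?thesis using e by simp
      qed
      then show "\<exists>N. \<forall>n\<ge>N. norm (onorm (\<lambda>v. poly_operator (p n) ?A v - ?B v) - 0) < e"
        unfolding diff by auto
    qed
  qed
  show ?thesis
    unfolding functional_calculus_def
  proof (rule the_equality)
    obtain p where p: "uniform_limit {0..onorm ?A} (\<lambda>n. poly (p n)) f sequentially"
      using poly_approximation[OF f] .
    show "bounded_linear ?B \<and> (\<exists>p. uniform_limit {0..onorm ?A} (\<lambda>n. poly (p n)) f sequentially \<and>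
        (\<lambda>n. onorm (\<lambda>v. poly_operator (p n) ?A v - ?B v)) \<longlonglongrightarrow> 0)"
      using spectral_op_bounded_linear[OF fh] p lim[OF p] by blast
  next
    fix B
    assume "bounded_linear B \<and> (\<exists>p. uniform_limit {0..onorm ?A} (\<lambda>n. poly (p n)) f sequentially \<and>
        (\<lambda>n. onorm (\<lambda>v. poly_operator (p n) ?A v - B v)) \<longlonglongrightarrow> 0)"
    then obtain p where B: "bounded_linear B"
      and p: "uniform_limit {0..onorm ?A} (\<lambda>n. poly (p n)) f sequentially"
      and pB: "(\<lambda>n. onorm (\<lambda>v. poly_operator (p n) ?A v - B v)) \<longlonglongrightarrow> 0" by blast
    \<comment> \<open>Norm convergence is weakened to pointwise convergence, so that
      \<open>B\<close> and \<open>?B\<close> become limits of the same sequence of vectors.\<close>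
    have pw: "(\<lambda>n. poly_operator (p n) ?A v) \<longlonglongrightarrow> T v"
      if "bounded_linear T" "(\<lambda>n. onorm (\<lambda>v. poly_operator (p n) ?A v - T v)) \<longlonglongrightarrow> 0" for T v
    proof (rule LIM_zero_cancel, rule Lim_null_comparison)
      have "bounded_linear (\<lambda>v. poly_operator (p n) ?A v - T v)" for n
        using spectral_op_bounded_linear[OF bounded_spec_poly[OF h(1)]] that(1)
        by (simp add: poly_operator_spectral_op h(1) bounded_linear_sub)
      then show "\<forall>\<^sub>F n in sequentially. norm (poly_operator (p n) ?A v - T v)
          \<le> onorm (\<lambda>v. poly_operator (p n) ?A v - T v) * norm v"
        using onorm by (intro always_eventually allI) blast
      show "(\<lambda>n. onorm (\<lambda>v. poly_operator (p n) ?A v - T v) * norm v) \<longlonglongrightarrow> 0"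
        using tendsto_mult_right[OF that(2), of "norm v"] by simp
    qed
    show "B = ?B"
    proof
      fix v
      show "B v = ?B v"
        by (rule LIMSEQ_unique[OF pw[OF B pB] pw[OF spectral_op_bounded_linear[OF fh] lim[OF p]]])
    qed
  qed
qed

subsection \<open>The operators of the method\<close>

lemma K_has_sum: "((\<lambda>j. (\<mu> j * (v \<bullet> x j)) *\<^sub>R y j) has_sum K v) J"
proof -
  interpret bounded_linear K by (rule K_bounded_linear)
  have "((\<lambda>j. K ((v \<bullet> x j) *\<^sub>R x j)) has_sum K (v - null_part v)) J"
    using has_sum_bounded_linear[OF K_bounded_linear has_sum_null_part] by (simp add: o_def)
  moreover have "K (v - null_part v) = K v" by (simp add: diff K_null_part)
  moreover have "K ((v \<bullet> x j) *\<^sub>R x j) = (\<mu> j * (v \<bullet> x j)) *\<^sub>R y j" if "j \<in> J" for j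
    by (simp add: scale K_x that mult.commute)
  ultimately show ?thesis using has_sum_cong by (metis (no_types, lifting))
qed

lemma K_inner: "j \<in> J \<Longrightarrow> K v \<bullet> y j = \<mu> j * (v \<bullet> x j)"
  by (rule orthonormal_has_sum_coeff[OF orthonormal_y K_has_sum])

text \<open>The constant \<open>adjoint\<close> is defined by choice, so an adjoint has to be
  exhibited. The series is verified by pairing it with \<open>v\<close> and comparing with the
  expansion of \<open>K v\<close> paired with \<open>w\<close>.\<close>

lemma adjoint_K: "adjoint K = (\<lambda>w. \<Sum>\<^sub>\<infinity>j\<in>J. (\<mu> j * (w \<bullet> y j)) *\<^sub>R x j)"
proof (rule adjoint_unique, intro allI)
  fix v w
  have "(\<lambda>j. (\<mu> j * (w \<bullet> y j)) *\<^sub>R x j) summable_on J"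
    by (rule orthonormal_multiplier_summable[OF orthonormal_y orthonormal_x, of _ "\<mu> 1"])
      (use \<mu>_le \<mu>_pos in \<open>auto simp: less_imp_le\<close>)
  then have "((\<lambda>j. (\<mu> j * (w \<bullet> y j)) * (x j \<bullet> v)) has_sum
      (\<Sum>\<^sub>\<infinity>j\<in>J. (\<mu> j * (w \<bullet> y j)) *\<^sub>R x j) \<bullet> v) J"
    by (intro has_sum_scaleR_inner) simp
  moreover have "((\<lambda>j. (\<mu> j * (v \<bullet> x j)) * (y j \<bullet> w)) has_sum K v \<bullet> w) J"
    by (rule has_sum_scaleR_inner[OF K_has_sum])
  ultimately show "K v \<bullet> w = v \<bullet> (\<Sum>\<^sub>\<infinity>j\<in>J. (\<mu> j * (w \<bullet> y j)) *\<^sub>R x j)"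
    using has_sum_unique by (fastforce simp: inner_commute mult_ac)
qed

lemma normal_operator_K: "normal_operator K = spectral_op (\<lambda>t. t)"
  unfolding normal_operator_def spectral_op_def adjoint_K
  by (auto simp: fun_eq_iff K_inner power2_eq_square mult.assoc intro!: infsum_cong)

text \<open>The largest eigenvalue is attained at \<open>x 1\<close>. This identifies the
  normalization in the weighted operator with the factor \<open>\<mu> 1\<close> in the
  filter.\<close>

lemma onorm_normal_operator: "onorm (normal_operator K) = (\<mu> 1)\<^sup>2"
proof (rule antisym)
  show "onorm (normal_operator K) \<le> (\<mu> 1)\<^sup>2"
    unfolding normal_operator_K using spec_subset by (intro spectral_op_onorm_le) auto
  show "(\<mu> 1)\<^sup>2 \<le> onorm (normal_operator K)"
    unfolding normal_operator_K
    using spectral_op_onorm_ge[OF bounded_spec_id \<mu>_in_spec[OF one_in_J]] by simp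
qed

text \<open>The symbol of \<open>weighted_operator\<close> in the variable \<open>t\<close>, the
  square of a singular value.\<close>

definition weight :: "nat \<Rightarrow> real \<Rightarrow> real \<Rightarrow> real" where
  "weight l \<alpha> t = t + \<alpha> * (1 - t / (\<mu> 1)\<^sup>2) ^ l"

lemma bounded_weight: "bounded (weight l \<alpha> ` spec)"
  unfolding weight_def using \<mu>_pos[OF one_in_J]
  by (intro bounded_spec_continuous continuous_intros) auto

lemma weighted_operator_K: "weighted_operator K l \<alpha> = spectral_op (weight l \<alpha>)"
proof
  fix v
  define c where "c = 1 / (\<mu> 1)\<^sup>2"
  have w: "weight l \<alpha> = (\<lambda>t. t + \<alpha> * (1 - c * t) ^ l)"
    by (simp add: weight_def c_def fun_eq_iff)
  have b: "bounded ((\<lambda>t. c * t) ` spec)"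
    by (intro bounded_spec_mult bounded_spec_const bounded_spec_id)
  have b1: "bounded ((\<lambda>t. 1 - c * t) ` spec)"
    by (rule bounded_minus_comp[OF bounded_spec_const b])
  have "(\<lambda>u. u - c *\<^sub>R spectral_op (\<lambda>t. t) u) = spectral_op (\<lambda>t. 1 - c * t)"
    using spectral_op_diff[OF bounded_spec_const b, of 1]
    by (simp add: fun_eq_iff spectral_op_scaleR[OF bounded_spec_id] spectral_op_const)
  then show "weighted_operator K l \<alpha> v = spectral_op (weight l \<alpha>) v"
    unfolding weighted_operator_def onorm_normal_operator w c_def[symmetric]
    unfolding normal_operator_K
    using spectral_op_add[OF bounded_spec_id bounded_spec_mult[OF bounded_spec_const bounded_spec_power[OF b1]]]
    by (simp add: spectral_op_power[OF b1] spectral_op_scaleR bounded_spec_power[OF b1])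
qed

lemma weight_pos:
  assumes "0 < \<alpha>" "t \<in> {0..(\<mu> 1)\<^sup>2}"
  shows "0 < weight l \<alpha> t"
\<comment> \<open>At 0 the second summand equals \<alpha>. At the right endpoint it vanishes for
  positive \<open>l\<close>, and positivity comes from \<open>t\<close>.\<close>
proof (cases "t = 0")
  case False
  have "0 \<le> 1 - t / (\<mu> 1)\<^sup>2" using assms(2) \<mu>_pos[OF one_in_J] by simp
  then have "0 \<le> \<alpha> * (1 - t / (\<mu> 1)\<^sup>2) ^ l" using assms(1) by simp
  then show ?thesis using assms(2) False by (simp add: weight_def)
qed (use assms in \<open>simp add: weight_def\<close>)

lemma operator_power_spectral_op:
  assumes "bounded (h ` spec)" "\<And>t. t \<in> spec \<Longrightarrow> 0 \<le> h t" "0 \<le> s"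
  shows "operator_power (spectral_op h) s = spectral_op (\<lambda>t. if s = 0 then 1 else h t powr s)"
    and "bounded ((\<lambda>t. if s = 0 then 1 else h t powr s) ` spec)"
proof -
  have c: "continuous_on {0..onorm (spectral_op h)} (\<lambda>t. if s = 0 then 1 else t powr s)"
    using assms(3) by (cases "s = 0") (auto intro!: continuous_intros continuous_on_powr')
  show "operator_power (spectral_op h) s = spectral_op (\<lambda>t. if s = 0 then 1 else h t powr s)"
    unfolding operator_power_def by (rule functional_calculus_spectral_op[OF assms(1,2) c])
  show "bounded ((\<lambda>t. if s = 0 then 1 else h t powr s) ` spec)"
    by (rule bounded_spec_compose[OF assms(1,2) c])
qed

lemma spec_nonneg: "t \<in> spec \<Longrightarrow> 0 \<le> t"
  using spec_subset by auto

end

subsection \<open>Estimates for the filter\<close>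

text \<open>Bernoulli's inequality for the integer exponent obtained by rounding \<open>r\<close>
  up; since \<open>a \<le> 1\<close>, lowering the exponent to \<open>r\<close> only increases the
  power.\<close>

lemma one_minus_powr_le:
  fixes a r :: real
  assumes "0 \<le> a" "a \<le> 1" "0 < r"
  shows "1 - a powr r \<le> real (nat \<lceil>r\<rceil>) * (1 - a)"
proof -
  let ?n = "nat \<lceil>r\<rceil>"
  have n: "0 < ?n" using assms(3) by simp
  have "1 + real ?n * (a - 1) \<le> (1 + (a - 1)) ^ ?n"
    using assms(1) by (intro Bernoulli_inequality) simp
  also have "\<dots> = a ^ ?n" by simp
  \<comment> \<open>Positivity of \<open>?n\<close> matters here: \<open>a\<close> may be 0, and
    \<open>0 powr 0\<close> is 0 while \<open>0 ^ 0\<close> is 1.\<close>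
  also have "\<dots> = a powr real ?n" using assms(1) n by (intro powr_realpow'[symmetric]) auto
  also have "\<dots> \<le> a powr r" using assms(1,2) by (intro powr_mono') (auto simp: of_nat_ceiling)
  finally show ?thesis by (simp add: algebra_simps)
qed

lemma one_minus_power_le:
  fixes a :: real
  assumes "0 \<le> a" "a \<le> 1"
  shows "1 - (1 - a) ^ m \<le> real m * a"
  using Bernoulli_inequality[of "- a" m] assms by simp

text \<open>The ratio is at most 1, so its exponent \<open>m\<close> may be lowered to
  \<open>s\<close>; then its product with \<open>t\<close> is at most \<alpha>. With
  \<open>s = \<sigma> / 2\<close> this is where \<open>\<sigma> \<le> 2 * m\<close> enters, the
  saturation of the method.\<close>

lemma tikhonov_source_bound:
  fixes \<alpha> t s :: real
  assumes "0 < \<alpha>" "0 \<le> t" "0 < s" "s \<le> real m"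
  shows "(\<alpha> / (t + \<alpha>)) ^ m * t powr s \<le> \<alpha> powr s"
proof -
  let ?a = "\<alpha> / (t + \<alpha>)"
  have a: "0 < ?a" "?a \<le> 1" using assms by auto
  have "?a ^ m = ?a powr real m" using a by (simp add: powr_realpow)
  also have "\<dots> \<le> ?a powr s" using a assms(4) by (intro powr_mono') auto
  finally have "?a ^ m * t powr s \<le> ?a powr s * t powr s" by (rule mult_right_mono) simp
  also have "\<dots> = (?a * t) powr s" by (simp only: powr_mult)
  also have "\<dots> \<le> \<alpha> powr s"
    using assms by (intro powr_mono2) (auto simp: field_simps)
  finally show ?thesis .
qed

text \<open>The two terms of the total error, approximation and noise, become equal for this
  \<alpha>.\<close>

lemma parameter_choice:
  fixes \<delta> E \<sigma> :: real
  assumes "0 < \<delta>" "0 < E" "0 \<le> \<sigma>"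
  defines "\<alpha> \<equiv> (\<delta> / E) powr (2 / (1 + \<sigma>))"
  shows "\<alpha> powr (\<sigma> / 2) * E = \<delta> powr (\<sigma> / (\<sigma> + 1)) * E powr (1 / (\<sigma> + 1))"
    and "\<delta> / sqrt \<alpha> = \<delta> powr (\<sigma> / (\<sigma> + 1)) * E powr (1 / (\<sigma> + 1))"
proof -
  have *: "1 - \<sigma> / (\<sigma> + 1) = 1 / (\<sigma> + 1)" "1 - 1 / (\<sigma> + 1) = \<sigma> / (\<sigma> + 1)"
    using assms(3) by (auto simp: field_simps)
  \<comment> \<open>Writing \<open>E\<close> and \<delta> themselves as such products lets the
    fractional powers cancel directly.\<close>
  have split: "z powr p * z powr (1 - p) = z" if "0 < z" for z p :: real
    using that by (simp flip: powr_add)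
  have E: "E powr (\<sigma> / (\<sigma> + 1)) * E powr (1 / (\<sigma> + 1)) = E"
    using split[OF assms(2), of "\<sigma> / (\<sigma> + 1)"] by (simp only: *)
  have D: "\<delta> powr (1 / (\<sigma> + 1)) * \<delta> powr (\<sigma> / (\<sigma> + 1)) = \<delta>"
    using split[OF assms(1), of "1 / (\<sigma> + 1)"] by (simp only: *)
  have exponents: "2 / (1 + \<sigma>) * (\<sigma> / 2) = \<sigma> / (\<sigma> + 1)" "2 / (1 + \<sigma>) * (1 / 2) = 1 / (\<sigma> + 1)"
    using assms(3) by (auto simp: field_simps)
  have "\<alpha> powr (\<sigma> / 2) = (\<delta> / E) powr (\<sigma> / (\<sigma> + 1))"
    by (simp only: \<alpha>_def powr_powr exponents)
  then have "\<alpha> powr (\<sigma> / 2) = \<delta> powr (\<sigma> / (\<sigma> + 1)) / E powr (\<sigma> / (\<sigma> + 1))"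
    by (simp add: powr_divide)
  then have "\<alpha> powr (\<sigma> / 2) * E = \<delta> powr (\<sigma> / (\<sigma> + 1)) / E powr (\<sigma> / (\<sigma> + 1))
      * (E powr (\<sigma> / (\<sigma> + 1)) * E powr (1 / (\<sigma> + 1)))"
    by (simp only: E)
  then show "\<alpha> powr (\<sigma> / 2) * E = \<delta> powr (\<sigma> / (\<sigma> + 1)) * E powr (1 / (\<sigma> + 1))"
    using assms(2) by simp
  have "sqrt \<alpha> = \<alpha> powr (1 / 2)" using assms by (simp add: \<alpha>_def powr_half_sqrt)
  also have "\<dots> = (\<delta> / E) powr (1 / (\<sigma> + 1))" by (simp only: \<alpha>_def powr_powr exponents)
  finally have "sqrt \<alpha> = \<delta> powr (1 / (\<sigma> + 1)) / E powr (1 / (\<sigma> + 1))"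
    by (simp add: powr_divide)
  then have "\<delta> / sqrt \<alpha> = \<delta> powr (1 / (\<sigma> + 1)) * \<delta> powr (\<sigma> / (\<sigma> + 1))
      / (\<delta> powr (1 / (\<sigma> + 1)) / E powr (1 / (\<sigma> + 1)))"
    by (simp only: D)
  then show "\<delta> / sqrt \<alpha> = \<delta> powr (\<sigma> / (\<sigma> + 1)) * E powr (1 / (\<sigma> + 1))"
    using assms(1) by simp
qed

section \<open>The filter in the variable \<open>t\<close>: residual, source and noise
  bounds\<close>

context compact_singular_system
begin

lemma mu1_pos: "0 < \<mu> 1"
  by (rule \<mu>_pos[OF one_in_J])

text \<open>\<open>fwt_filter\<close> as a function of \<open>t = \<mu>\<^sup>2\<close>.\<close>

definition spectral_filter :: "real \<Rightarrow> nat \<Rightarrow> real \<Rightarrow> real \<Rightarrow> real" where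
  "spectral_filter r l \<alpha> t = (t / weight l \<alpha> t) powr r"

lemma fwt_filter_\<mu>: "fwt_filter (\<mu> 1) r l \<alpha> (\<mu> j) = spectral_filter r l \<alpha> ((\<mu> j)\<^sup>2)"
  by (simp add: fwt_filter_def spectral_filter_def weight_def power_divide)

lemma ifwt_filter_\<mu>:
  "ifwt_filter (\<mu> 1) r l m \<alpha> (\<mu> j) = 1 - (1 - spectral_filter r l \<alpha> ((\<mu> j)\<^sup>2)) ^ m"
  unfolding ifwt_filter_def fwt_filter_\<mu> ..

lemma weight_factor_bounds:
  assumes "t \<in> {0..(\<mu> 1)\<^sup>2}"
  shows "0 \<le> 1 - t / (\<mu> 1)\<^sup>2" "1 - t / (\<mu> 1)\<^sup>2 \<le> 1"
  using assms mu1_pos by auto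

lemma weight_ge:
  assumes "0 < \<alpha>" "t \<in> {0..(\<mu> 1)\<^sup>2}"
  shows "t \<le> weight l \<alpha> t"
  using weight_factor_bounds[OF assms(2)] assms(1) by (simp add: weight_def)

lemma weight_ratio_bounds:
  assumes "0 < \<alpha>" "t \<in> {0..(\<mu> 1)\<^sup>2}"
  shows "0 \<le> t / weight l \<alpha> t" "t / weight l \<alpha> t \<le> 1"
  using weight_ge[OF assms, of l] weight_pos[OF assms, of l] assms(2) by auto

lemma spectral_filter_bounds:
  assumes "0 < \<alpha>" "0 \<le> r" "t \<in> {0..(\<mu> 1)\<^sup>2}"
  shows "0 \<le> spectral_filter r l \<alpha> t" "spectral_filter r l \<alpha> t \<le> 1"
  using weight_ratio_bounds[OF assms(1,3), of l] assms(2)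
  by (auto simp: spectral_filter_def intro!: powr_le1)

text \<open>For \<open>r = 1\<close> the residual is
  \<open>\<alpha> * s / (t + \<alpha> * s)\<close>, which increases with \<open>s \<le> 1\<close>;
  the unweighted case \<open>s = 1\<close> dominates. The exponent \<open>r\<close> costs the
  constant factor from Bernoulli.\<close>

lemma spectral_filter_residual_le:
  assumes "0 < \<alpha>" "0 < r" "t \<in> {0..(\<mu> 1)\<^sup>2}"
  shows "1 - spectral_filter r l \<alpha> t \<le> real (nat \<lceil>r\<rceil>) * (\<alpha> / (t + \<alpha>))"
proof -
  define s where "s = (1 - t / (\<mu> 1)\<^sup>2) ^ l"
  have s: "0 \<le> s" "s \<le> 1"
    using weight_factor_bounds[OF assms(3)] by (auto simp: s_def power_le_one)
  have w: "weight l \<alpha> t = t + \<alpha> * s" by (simp add: weight_def s_def)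
  have pos: "0 < t + \<alpha> * s" "0 < t + \<alpha>"
    using weight_pos[OF assms(1,3), of l] assms(1,3) by (auto simp: w)
  have "1 - t / weight l \<alpha> t = \<alpha> * s / (t + \<alpha> * s)"
    using pos by (simp add: w field_simps)
  also have "\<dots> \<le> \<alpha> / (t + \<alpha>)"
  proof -
    have "s * t \<le> t" using s assms(3) by (simp add: mult_left_le_one_le)
    then have "\<alpha> * (s * t) \<le> \<alpha> * t" using assms(1) by simp
    then have "\<alpha> * s * (t + \<alpha>) \<le> \<alpha> * (t + \<alpha> * s)" by (simp add: algebra_simps)
    then show ?thesis using pos by (simp add: pos_divide_le_eq pos_le_divide_eq)
  qed
  finally have "1 - t / weight l \<alpha> t \<le> \<alpha> / (t + \<alpha>)" .
  moreover have "1 - spectral_filter r l \<alpha> t \<le> real (nat \<lceil>r\<rceil>) * (1 - t / weight l \<alpha> t)"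
    unfolding spectral_filter_def
    by (rule one_minus_powr_le[OF weight_ratio_bounds[OF assms(1,3)] assms(2)])
  ultimately show ?thesis
    by (meson mult_left_mono of_nat_0_le_iff order_trans)
qed

lemma source_error_bound:
  assumes "0 < \<alpha>" "0 < r" "t \<in> {0..(\<mu> 1)\<^sup>2}" "0 \<le> \<sigma>" "\<sigma> \<le> 2 * real m"
  shows "\<bar>(1 - spectral_filter r l \<alpha> t) ^ m * (if \<sigma> / 2 = 0 then 1 else t powr (\<sigma> / 2))\<bar>
    \<le> real (nat \<lceil>r\<rceil>) ^ m * \<alpha> powr (\<sigma> / 2)"
proof -
  let ?q = "spectral_filter r l \<alpha> t" and ?N = "real (nat \<lceil>r\<rceil>)"
  let ?p = "if \<sigma> / 2 = 0 then 1 else t powr (\<sigma> / 2)"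
  have q: "0 \<le> 1 - ?q" using spectral_filter_bounds[of \<alpha> r t l] assms by simp
  have "(1 - ?q) ^ m \<le> (?N * (\<alpha> / (t + \<alpha>))) ^ m"
    by (rule power_mono[OF spectral_filter_residual_le[OF assms(1-3)] q])
  then have "(1 - ?q) ^ m * ?p \<le> ?N ^ m * ((\<alpha> / (t + \<alpha>)) ^ m * ?p)"
    by (simp only: power_mult_distrib mult.assoc[symmetric]) (rule mult_right_mono, simp_all)
  also have "\<dots> \<le> ?N ^ m * \<alpha> powr (\<sigma> / 2)"
  proof (rule mult_left_mono)
    show "(\<alpha> / (t + \<alpha>)) ^ m * ?p \<le> \<alpha> powr (\<sigma> / 2)"
    proof (cases "\<sigma> = 0")
      case True
      then show ?thesis using assms(1,3) by (auto intro!: power_le_one)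
    next
      case False
      then show ?thesis using tikhonov_source_bound[of \<alpha> t "\<sigma> / 2" m] assms by simp
    qed
  qed simp
  finally show ?thesis using q by (simp add: abs_mult)
qed

lemma ifwt_filter_bounds:
  assumes "0 < \<alpha>" "0 \<le> r" "j \<in> J"
  shows "0 \<le> ifwt_filter (\<mu> 1) r l m \<alpha> (\<mu> j)" "ifwt_filter (\<mu> 1) r l m \<alpha> (\<mu> j) \<le> 1"
  using spectral_filter_bounds[OF assms(1,2), of "(\<mu> j)\<^sup>2" l] \<mu>_sq_le[OF assms(3)]
  unfolding ifwt_filter_\<mu> by (auto intro!: power_le_one)

text \<open>Iteration multiplies the filter by at most \<open>m\<close>. As
  \<open>r \<ge> 1 / 2\<close> and the ratio lies in [0, 1], its power is at most its square root,
  whose numerator \<open>\<mu> j\<close> cancels the singular value in the denominator.\<close>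

lemma noise_amplification_bound:
  assumes "0 < \<alpha>" "1 / 2 \<le> r" "j \<in> J" "0 < b" "\<And>t. t \<in> {0..(\<mu> 1)\<^sup>2} \<Longrightarrow> b \<le> weight l \<alpha> t"
  shows "\<bar>ifwt_filter (\<mu> 1) r l m \<alpha> (\<mu> j) / \<mu> j\<bar> \<le> real m / sqrt b"
proof -
  define t where "t = (\<mu> j)\<^sup>2"
  have t: "t \<in> {0..(\<mu> 1)\<^sup>2}" using \<mu>_sq_le[OF assms(3)] by (simp add: t_def)
  have mu: "0 < \<mu> j" "sqrt t = \<mu> j" using \<mu>_pos[OF assms(3)] by (auto simp: t_def)
  let ?q = "spectral_filter r l \<alpha> t"
  have q: "0 \<le> ?q" "?q \<le> 1" using spectral_filter_bounds[OF assms(1) _ t, of r l] assms(2) by auto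
  have wr: "0 \<le> t / weight l \<alpha> t" "t / weight l \<alpha> t \<le> 1"
    by (rule weight_ratio_bounds[OF assms(1) t])+
  have "ifwt_filter (\<mu> 1) r l m \<alpha> (\<mu> j) \<le> real m * ?q"
    using one_minus_power_le[OF q] by (simp only: ifwt_filter_\<mu> t_def)
  also have "?q \<le> (t / weight l \<alpha> t) powr (1 / 2)"
    unfolding spectral_filter_def by (rule powr_mono'[OF assms(2) wr])
  also have "\<dots> = \<mu> j / sqrt (weight l \<alpha> t)"
    using wr by (simp add: powr_half_sqrt real_sqrt_divide mu)
  also have "\<dots> \<le> \<mu> j / sqrt b"
    using assms(4) assms(5)[OF t] mu by (intro divide_left_mono) auto
  finally have "ifwt_filter (\<mu> 1) r l m \<alpha> (\<mu> j) \<le> real m * (\<mu> j / sqrt b)"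
    by (simp add: mult_left_mono)
  then show ?thesis
    using ifwt_filter_bounds(1)[OF assms(1) _ assms(3), of r l m] assms(2) mu
    by (simp add: field_simps)
qed

text \<open>In the lower half of the interval the weighted term keeps at least
  \<open>\<alpha> / 2 ^ l\<close>. In the upper half, where that term may vanish, \<open>t\<close>
  itself is at least half of the squared \<open>\<mu> 1\<close>, which dominates a multiple of
  \<alpha> as long as \<open>\<alpha> \<le> A\<close>.\<close>

lemma weight_lower_bound:
  assumes "0 < \<alpha>" "\<alpha> \<le> A" "t \<in> {0..(\<mu> 1)\<^sup>2}"
  shows "min (1 / 2 ^ l) ((\<mu> 1)\<^sup>2 / (2 * A)) * \<alpha> \<le> weight l \<alpha> t"
proof (cases "t \<le> (\<mu> 1)\<^sup>2 / 2")
  case True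
  have "(1 / 2) ^ l \<le> (1 - t / (\<mu> 1)\<^sup>2) ^ l"
    using True mu1_pos by (intro power_mono) (auto simp: field_simps)
  then have "1 / 2 ^ l * \<alpha> \<le> (1 - t / (\<mu> 1)\<^sup>2) ^ l * \<alpha>"
    using assms(1) by (intro mult_right_mono) (auto simp: power_one_over)
  moreover have "min (1 / 2 ^ l) ((\<mu> 1)\<^sup>2 / (2 * A)) * \<alpha> \<le> 1 / 2 ^ l * \<alpha>"
    using assms(1) by (intro mult_right_mono) auto
  moreover have "0 \<le> t" using assms(3) by simp
  ultimately show ?thesis unfolding weight_def by (simp add: mult.commute)
next
  case False
  have "min (1 / 2 ^ l) ((\<mu> 1)\<^sup>2 / (2 * A)) * \<alpha> \<le> (\<mu> 1)\<^sup>2 / (2 * A) * A"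
    using assms(1,2) by (intro mult_mono) auto
  also have "\<dots> \<le> t" using assms(1,2) False by simp
  also have "\<dots> \<le> weight l \<alpha> t" by (rule weight_ge[OF assms(1,3)])
  finally show ?thesis .
qed

lemma noise_amplification_bounded:
  assumes "0 < \<alpha>" "1 / 2 \<le> r"
  obtains C where "0 \<le> C" "\<And>j. j \<in> J \<Longrightarrow> \<bar>ifwt_filter (\<mu> 1) r l m \<alpha> (\<mu> j) / \<mu> j\<bar> \<le> C"
proof -
  define b where "b = min (1 / 2 ^ l) ((\<mu> 1)\<^sup>2 / (2 * \<alpha>)) * \<alpha>"
  have b: "0 < b" using assms(1) mu1_pos by (simp add: b_def)
  have bound: "\<bar>ifwt_filter (\<mu> 1) r l m \<alpha> (\<mu> j) / \<mu> j\<bar> \<le> real m / sqrt b" if "j \<in> J" for j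
    by (rule noise_amplification_bound[OF assms that b])
      (use weight_lower_bound[OF assms(1) order_refl] in \<open>simp add: b_def\<close>)
  show thesis by (rule that[OF _ bound]) (use b in simp)
qed

lemma filter_function_ifwt:
  assumes "1 / 2 \<le> r" "1 \<le> m"
  shows "filter_function J \<mu> (ifwt_filter (\<mu> 1) r l m)"
  unfolding filter_function_def
proof (intro conjI allI impI ballI)
  fix \<alpha> :: real assume "0 < \<alpha>"
  then obtain C where "\<And>j. j \<in> J \<Longrightarrow> \<bar>ifwt_filter (\<mu> 1) r l m \<alpha> (\<mu> j) / \<mu> j\<bar> \<le> C"
    using noise_amplification_bounded assms(1) by metis
  then show "bdd_above ((\<lambda>j. \<bar>ifwt_filter (\<mu> 1) r l m \<alpha> (\<mu> j) / \<mu> j\<bar>) ` J)"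
    by (intro bdd_aboveI2)
next
  have "\<bar>ifwt_filter (\<mu> 1) r l m \<alpha> (\<mu> j)\<bar> \<le> 1" if "0 < \<alpha>" "j \<in> J" for \<alpha> j
    using ifwt_filter_bounds[OF that(1) _ that(2), of r l m] assms(1) by simp
  then show "\<exists>c. \<forall>\<alpha>>0. \<forall>j\<in>J. \<bar>ifwt_filter (\<mu> 1) r l m \<alpha> (\<mu> j)\<bar> \<le> c" by blast
next
  fix j assume j: "j \<in> J"
  have "((\<lambda>\<alpha>. ifwt_filter (\<mu> 1) r l m \<alpha> (\<mu> j)) \<longlongrightarrow>
      1 - (1 - ((\<mu> j)\<^sup>2 / ((\<mu> j)\<^sup>2 + 0 * (1 - (\<mu> j / \<mu> 1)\<^sup>2) ^ l)) powr r) ^ m) (at_right 0)"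
    unfolding ifwt_filter_def fwt_filter_def
    using \<mu>_pos[OF j] by (intro tendsto_intros) auto
  \<comment> \<open>At \<alpha> = 0 the base of the power is 1, so the limit is
    \<open>1 - 0 ^ m\<close>, which equals 1 because \<open>m \<ge> 1\<close>.\<close>
  then show "((\<lambda>\<alpha>. ifwt_filter (\<mu> 1) r l m \<alpha> (\<mu> j)) \<longlongrightarrow> 1) (at_right 0)"
    using \<mu>_pos[OF j] assms(2) by (simp add: power_0_left)
qed

subsection \<open>The iterates\<close>

lemma null_part_diff: "null_part (u - v) = null_part u - null_part v"
  using null_part_add[of u "(-1) *\<^sub>R v"] null_part_scaleR[of "-1" v] by simp

lemma operator_power_normal:
  assumes "0 \<le> s"
  shows "operator_power (normal_operator K) s = spectral_op (\<lambda>t. if s = 0 then 1 else t powr s)"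
    and "bounded ((\<lambda>t. if s = 0 then 1 else t powr s) ` spec)"
  unfolding normal_operator_K
  by (rule operator_power_spectral_op[OF bounded_spec_id spec_nonneg assms]; assumption)+

lemma operator_power_weighted:
  assumes "0 < \<alpha>" "0 < s"
  shows "operator_power (weighted_operator K l \<alpha>) s = spectral_op (\<lambda>t. weight l \<alpha> t powr s)"
    and "bounded ((\<lambda>t. weight l \<alpha> t powr s) ` spec)"
proof -
  have "0 \<le> weight l \<alpha> t" if "t \<in> spec" for t
    using weight_pos[OF assms(1), of t l] spec_subset that by (simp add: less_imp_le subset_iff)
  from operator_power_spectral_op[OF bounded_weight this less_imp_le[OF assms(2)]]
  show "operator_power (weighted_operator K l \<alpha>) s = spectral_op (\<lambda>t. weight l \<alpha> t powr s)"
    and "bounded ((\<lambda>t. weight l \<alpha> t powr s) ` spec)"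
    using assms(2) by (simp_all add: weighted_operator_K)
qed

lemma fractional_adjoint_has_sum:
  assumes "1 / 2 \<le> r"
  shows "((\<lambda>j. (\<mu> j powr (2 * r - 1) * (w \<bullet> y j)) *\<^sub>R x j) has_sum fractional_adjoint J \<mu> x y r w) J"
proof -
  have "\<bar>\<mu> j powr (2 * r - 1)\<bar> \<le> \<mu> 1 powr (2 * r - 1)" if "j \<in> J" for j
    using \<mu>_pos[OF that] \<mu>_le[OF that] assms by (simp add: powr_mono2)
  from orthonormal_multiplier_summable[OF orthonormal_y orthonormal_x this]
  show ?thesis by (simp add: fractional_adjoint_def)
qed

text \<open>Induction on the iteration. The series for the next iterate is taken as candidate
  \<open>u'\<close>; it solves the implicit equation coordinate by coordinate, and injectivity of
  the left-hand operator identifies it with the \<open>THE\<close> in the definition.\<close>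

lemma ifwt_has_sum:
  assumes "0 < \<alpha>" "1 / 2 \<le> r"
  shows "((\<lambda>j. (ifwt_filter (\<mu> 1) r l k \<alpha> (\<mu> j) / \<mu> j * (w \<bullet> y j)) *\<^sub>R x j)
    has_sum ifwt K J \<mu> x y r l k \<alpha> w) J"
proof (induction k)
  case 0
  show ?case by (simp add: ifwt_filter_def)
next
  case (Suc k)
  let ?Q = "\<lambda>k j. ifwt_filter (\<mu> 1) r l k \<alpha> (\<mu> j)"
  let ?W = "\<lambda>t. weight l \<alpha> t powr r" and ?P = "\<lambda>t. t powr r"
  define u where "u = ifwt K J \<mu> x y r l k \<alpha> w"
  define f where "f = fractional_adjoint J \<mu> x y r w"
  define u' where "u' = (\<Sum>\<^sub>\<infinity>j\<in>J. (?Q (Suc k) j / \<mu> j * (w \<bullet> y j)) *\<^sub>R x j)"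
  have r: "0 < r" using assms(2) by simp
  note W = operator_power_weighted[OF assms(1) r, of l]
  have P: "operator_power (normal_operator K) r = spectral_op ?P" "bounded (?P ` spec)"
    using operator_power_normal[of r] r by simp_all
  have u: "((\<lambda>j. (?Q k j / \<mu> j * (w \<bullet> y j)) *\<^sub>R x j) has_sum u) J"
    using Suc.IH by (simp add: u_def)
  have f: "((\<lambda>j. (\<mu> j powr (2 * r - 1) * (w \<bullet> y j)) *\<^sub>R x j) has_sum f) J"
    unfolding f_def by (rule fractional_adjoint_has_sum[OF assms(2)])
  obtain C where C: "\<And>j. j \<in> J \<Longrightarrow> \<bar>?Q (Suc k) j / \<mu> j\<bar> \<le> C"
    using noise_amplification_bounded[OF assms] by metis
  have u': "((\<lambda>j. (?Q (Suc k) j / \<mu> j * (w \<bullet> y j)) *\<^sub>R x j) has_sum u') J"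
    unfolding u'_def
    using orthonormal_multiplier_summable[OF orthonormal_y orthonormal_x C] by simp
  have solves: "spectral_op ?W u' = f + (spectral_op ?W u - spectral_op ?P u)"
  proof (rule eq_by_coordinates)
    show "null_part (spectral_op ?W u') = null_part (f + (spectral_op ?W u - spectral_op ?P u))"
      by (simp add: null_part_add null_part_diff spectral_op_null_part[OF W(2)]
          spectral_op_null_part[OF P(2)] null_part_has_sum[OF u] null_part_has_sum[OF f]
          null_part_has_sum[OF u'])
    fix j assume j: "j \<in> J"
    define t where "t = (\<mu> j)\<^sup>2"
    have mu: "0 < \<mu> j" by (rule \<mu>_pos[OF j])
    have t: "t \<in> {0..(\<mu> 1)\<^sup>2}" using \<mu>_sq_le[OF j] by (simp add: t_def)
    have w0: "0 < weight l \<alpha> t" by (rule weight_pos[OF assms(1) t])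
    define q where "q = spectral_filter r l \<alpha> t"
    \<comment> \<open>Multiplied by the symbol of the left-hand operator, the filter turns into the
      symbol of the power of K*K. This translates the recursion for \<open>Q\<close> into the
      implicit equation.\<close>
    have q: "q * ?W t = t powr r"
      using w0 by (simp add: q_def spectral_filter_def powr_divide)
    have Qk: "?Q k j = 1 - (1 - q) ^ k" for k
      by (simp only: ifwt_filter_\<mu> q_def t_def)
    have Qrec: "?Q (Suc k) j = q + (1 - q) * ?Q k j" unfolding Qk by (simp add: algebra_simps)
    have "t powr r = \<mu> j powr (2 * r)"
      using mu by (simp add: t_def powr_powr flip: powr_numeral)
    \<comment> \<open>The coefficient of \<open>fractional_adjoint\<close> is brought to the form of
      a filter coefficient, with \<open>\<mu> j\<close> in the denominator.\<close>
    then have tm: "\<mu> j powr (2 * r - 1) = t powr r / \<mu> j" using mu by (simp add: powr_diff)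
    have "?W t * ?Q (Suc k) j = q * ?W t + (?W t - q * ?W t) * ?Q k j"
      unfolding Qrec by (simp add: algebra_simps)
    then have step: "?W t * ?Q (Suc k) j = t powr r + (?W t - t powr r) * ?Q k j"
      by (simp only: q)
    have cu': "u' \<bullet> x j = ?Q (Suc k) j / \<mu> j * (w \<bullet> y j)"
      and cu: "u \<bullet> x j = ?Q k j / \<mu> j * (w \<bullet> y j)"
      and cf: "f \<bullet> x j = t powr r / \<mu> j * (w \<bullet> y j)"
      using orthonormal_has_sum_coeff[OF orthonormal_x u' j]
        orthonormal_has_sum_coeff[OF orthonormal_x u j]
        orthonormal_has_sum_coeff[OF orthonormal_x f j] by (auto simp: tm)
    have "spectral_op ?W u' \<bullet> x j = ?W t * ?Q (Suc k) j / \<mu> j * (w \<bullet> y j)"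
      by (simp add: spectral_op_inner[OF W(2) j] cu' t_def)
    also have "\<dots> = (t powr r + (?W t - t powr r) * ?Q k j) / \<mu> j * (w \<bullet> y j)"
      by (simp only: step)
    also have "\<dots> = (f + (spectral_op ?W u - spectral_op ?P u)) \<bullet> x j"
      using r mu by (simp add: inner_add_left inner_diff_left spectral_op_inner[OF W(2) j]
          spectral_op_inner[OF P(2) j] cu cf field_simps flip: t_def)
    finally show "spectral_op ?W u' \<bullet> x j = (f + (spectral_op ?W u - spectral_op ?P u)) \<bullet> x j" .
  qed
  \<comment> \<open>The symbol \<open>?W\<close> is nonzero on the whole interval, including at 0,
    so it can be cancelled both in the coordinates and in the kernel part.\<close>
  have inj: "v = u'" if "spectral_op ?W v = spectral_op ?W u'" for v
  proof (rule eq_by_coordinates)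
    have W_pos: "?W t \<noteq> 0" if "t \<in> {0..(\<mu> 1)\<^sup>2}" for t
      using weight_pos[OF assms(1) that, of l] by simp
    show "v \<bullet> x j = u' \<bullet> x j" if j: "j \<in> J" for j
      using arg_cong[OF \<open>spectral_op ?W v = spectral_op ?W u'\<close>, of "\<lambda>z. z \<bullet> x j"]
        W_pos[of "(\<mu> j)\<^sup>2"] \<mu>_sq_le[OF j] by (simp add: spectral_op_inner[OF W(2) j])
    show "null_part v = null_part u'"
      using arg_cong[OF that, of null_part] W_pos[of 0] by (simp add: spectral_op_null_part[OF W(2)])
  qed
  have "ifwt K J \<mu> x y r l (Suc k) \<alpha> w = u'"
    unfolding ifwt.simps W(1) P(1) u_def[symmetric] f_def[symmetric]
    by (rule the_equality, rule solves) (rule inj, simp only: solves)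
  then show ?case using u' by simp
qed

lemma filter_based_regularization_ifwt:
  assumes "1 / 2 \<le> r" "1 \<le> m"
  shows "filter_based_regularization J \<mu> x y (ifwt_filter (\<mu> 1) r l m) (ifwt K J \<mu> x y r l m)"
  unfolding filter_based_regularization_def
  using filter_function_ifwt[OF assms] ifwt_has_sum[OF _ assms(1)] by blast

subsection \<open>Convergence rates\<close>

text \<open>For \<open>v\<close> in the source set the error is \<open>spectral_op ?h z\<close>,
  with the residual to the power \<open>m\<close> times the source factor as symbol, so its norm is
  controlled by \<open>source_error_bound\<close>.\<close>

lemma exact_data_error:
  fixes z :: 'a
  assumes "0 < \<alpha>" "1 / 2 \<le> r" "0 \<le> \<sigma>" "\<sigma> \<le> 2 * real m"
  defines "v \<equiv> operator_power (normal_operator K) (\<sigma> / 2) z"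
  shows "norm (v - ifwt K J \<mu> x y r l m \<alpha> (K v)) \<le> real (nat \<lceil>r\<rceil>) ^ m * \<alpha> powr (\<sigma> / 2) * norm z"
proof -
  let ?p = "\<lambda>t. if \<sigma> / 2 = 0 then 1 else t powr (\<sigma> / 2)"
  let ?h = "\<lambda>t. (1 - spectral_filter r l \<alpha> t) ^ m * ?p t"
  define u where "u = ifwt K J \<mu> x y r l m \<alpha> (K v)"
  have r: "0 < r" using assms(2) by simp
  have p: "v = spectral_op ?p z" "bounded (?p ` spec)"
    using operator_power_normal[of "\<sigma> / 2"] assms(3) by (auto simp: v_def)
  have h: "\<bar>?h t\<bar> \<le> real (nat \<lceil>r\<rceil>) ^ m * \<alpha> powr (\<sigma> / 2)" if "t \<in> spec" for t
    using source_error_bound[OF assms(1) r _ assms(3,4)] that spec_subset by blast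
  then have bh: "bounded (?h ` spec)" unfolding bounded_iff real_norm_def by blast
  have u: "((\<lambda>j. (ifwt_filter (\<mu> 1) r l m \<alpha> (\<mu> j) / \<mu> j * (K v \<bullet> y j)) *\<^sub>R x j) has_sum u) J"
    unfolding u_def by (rule ifwt_has_sum[OF assms(1,2)])
  have "v - u = spectral_op ?h z"
  proof (rule spectral_op_eqI[OF bh])
    fix j assume j: "j \<in> J"
    have "u \<bullet> x j = ifwt_filter (\<mu> 1) r l m \<alpha> (\<mu> j) * (v \<bullet> x j)"
      using orthonormal_has_sum_coeff[OF orthonormal_x u j] \<mu>_pos[OF j] by (simp add: K_inner[OF j])
    then have "(v - u) \<bullet> x j = (1 - ifwt_filter (\<mu> 1) r l m \<alpha> (\<mu> j)) * (v \<bullet> x j)"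
      by (simp add: inner_diff_left algebra_simps)
    also have "v \<bullet> x j = ?p ((\<mu> j)\<^sup>2) * (z \<bullet> x j)"
      unfolding p(1) by (rule spectral_op_inner[OF p(2) j])
    also have "1 - ifwt_filter (\<mu> 1) r l m \<alpha> (\<mu> j) = (1 - spectral_filter r l \<alpha> ((\<mu> j)\<^sup>2)) ^ m"
      by (simp add: ifwt_filter_\<mu>[unfolded One_nat_def])
    finally show "(v - u) \<bullet> x j = ?h ((\<mu> j)\<^sup>2) * (z \<bullet> x j)" by (simp only: mult.assoc)
  next
    \<comment> \<open>The reconstruction has no kernel component and the filter vanishes at 0, so
      the kernel part of \<open>v\<close> remains entirely in the error. For positive \<sigma> it is
      0, for \<sigma> = 0 it need not be.\<close>
    have "null_part (v - u) = ?p 0 *\<^sub>R null_part z"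
      unfolding null_part_diff null_part_has_sum[OF u] p(1) spectral_op_null_part[OF p(2)] by simp
    then show "null_part (v - u) = ?h 0 *\<^sub>R null_part z" by (simp add: spectral_filter_def)
  qed
  then show ?thesis
    unfolding u_def[symmetric] using spectral_op_norm_le[OF _ h, where v = z] by simp
qed

text \<open>Linearity in the data is read off the series, and the difference is again a multiplier
  applied to \<open>v - w\<close>.\<close>

lemma data_error:
  assumes "0 < \<alpha>" "1 / 2 \<le> r" "0 < b" "\<And>t. t \<in> {0..(\<mu> 1)\<^sup>2} \<Longrightarrow> b \<le> weight l \<alpha> t"
  shows "norm (ifwt K J \<mu> x y r l m \<alpha> v - ifwt K J \<mu> x y r l m \<alpha> w) \<le> real m / sqrt b * norm (v - w)"
proof -
  have "((\<lambda>j. - ((ifwt_filter (\<mu> 1) r l m \<alpha> (\<mu> j) / \<mu> j * (w \<bullet> y j)) *\<^sub>R x j))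
      has_sum - ifwt K J \<mu> x y r l m \<alpha> w) J"
    using ifwt_has_sum[OF assms(1,2)] by (simp add: has_sum_uminus)
  from has_sum_add[OF ifwt_has_sum[OF assms(1,2), of l m v] this]
  have "((\<lambda>j. (ifwt_filter (\<mu> 1) r l m \<alpha> (\<mu> j) / \<mu> j * ((v - w) \<bullet> y j)) *\<^sub>R x j)
      has_sum (ifwt K J \<mu> x y r l m \<alpha> v - ifwt K J \<mu> x y r l m \<alpha> w)) J"
    by (simp add: inner_diff_left right_diff_distrib diff_divide_distrib scaleR_left_diff_distrib)
  from orthonormal_multiplier_norm_le[OF orthonormal_y orthonormal_x
      noise_amplification_bound[OF assms(1,2) _ assms(3,4)] _ this]
  show ?thesis using assms(3) by simp
qed

text \<open>The triangle inequality through the reconstruction from exact data; by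
  \<open>parameter_choice\<close> both parts are multiples of the same rate. The constant involves
  only \<open>r\<close>, \<open>m\<close> and \<open>c\<close>.\<close>

lemma worst_case_error_le:
  assumes "1 / 2 \<le> r" "0 \<le> \<sigma>" "\<sigma> \<le> 2 * real m" "0 < \<delta>" "0 < E" "0 < c"
  defines "\<alpha> \<equiv> (\<delta> / E) powr (2 / (1 + \<sigma>))"
  assumes weight: "\<And>t. t \<in> {0..(\<mu> 1)\<^sup>2} \<Longrightarrow> c * \<alpha> \<le> weight l \<alpha> t"
  shows "worst_case_error K (ifwt K J \<mu> x y r l m \<alpha>) \<sigma> E \<delta>
    \<le> ereal ((real (nat \<lceil>r\<rceil>) ^ m + real m / sqrt c) * \<delta> powr (\<sigma> / (\<sigma> + 1)) * E powr (1 / (\<sigma> + 1)))"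
  unfolding worst_case_error_def
proof (rule SUP_least, clarsimp simp: source_set_def)
  fix w and z :: 'a assume z: "norm z \<le> E"
  let ?v = "operator_power (normal_operator K) (\<sigma> / 2) z" and ?R = "ifwt K J \<mu> x y r l m \<alpha>"
  assume w: "norm (K ?v - w) \<le> \<delta>"
  define \<rho> where "\<rho> = \<delta> powr (\<sigma> / (\<sigma> + 1)) * E powr (1 / (\<sigma> + 1))"
  have \<alpha>: "0 < \<alpha>" using assms by (simp add: \<alpha>_def)
  have rate: "\<alpha> powr (\<sigma> / 2) * E = \<rho>" "\<delta> / sqrt \<alpha> = \<rho>"
    using parameter_choice[OF assms(4,5,2)] by (auto simp: \<alpha>_def \<rho>_def)
  have "norm (?v - ?R (K ?v)) \<le> real (nat \<lceil>r\<rceil>) ^ m * \<alpha> powr (\<sigma> / 2) * norm z"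
    by (rule exact_data_error[OF \<alpha> assms(1-3)])
  also have "\<dots> \<le> real (nat \<lceil>r\<rceil>) ^ m * \<alpha> powr (\<sigma> / 2) * E"
    by (rule mult_left_mono[OF z]) simp
  also have "\<dots> = real (nat \<lceil>r\<rceil>) ^ m * \<rho>" by (simp add: rate(1) mult.assoc)
  finally have 1: "norm (?v - ?R (K ?v)) \<le> real (nat \<lceil>r\<rceil>) ^ m * \<rho>" .
  have "norm (?R (K ?v) - ?R w) \<le> real m / sqrt (c * \<alpha>) * norm (K ?v - w)"
    by (rule data_error[OF \<alpha> assms(1) _ weight]) (use assms(6) \<alpha> in simp)
  also have "\<dots> \<le> real m / sqrt (c * \<alpha>) * \<delta>"
    by (rule mult_left_mono[OF w]) (use assms(6) \<alpha> in simp)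
  also have "\<dots> = real m / sqrt c * (\<delta> / sqrt \<alpha>)" by (simp add: real_sqrt_mult)
  finally have 2: "norm (?R (K ?v) - ?R w) \<le> real m / sqrt c * \<rho>" by (simp only: rate(2))
  have "norm (?v - ?R w) \<le> norm (?v - ?R (K ?v)) + norm (?R (K ?v) - ?R w)"
    using norm_triangle_ineq[of "?v - ?R (K ?v)" "?R (K ?v) - ?R w"] by simp
  with 1 2 have "norm (?v - ?R w) \<le> (real (nat \<lceil>r\<rceil>) ^ m + real m / sqrt c) * \<rho>"
    by (simp add: distrib_right)
  then show "norm (?v - ?R w) \<le> (real (nat \<lceil>r\<rceil>) ^ m + real m / sqrt c) *
      \<delta> powr (\<sigma> / (\<sigma> + 1)) * E powr (1 / (\<sigma> + 1))"
    by (simp add: \<rho>_def mult.assoc)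
qed

text \<open>A bound on \<open>\<delta> / E\<close> bounds \<alpha>, which makes the constant in
  \<open>weight_lower_bound\<close> uniform.\<close>

lemma worst_case_error_le_bounded_ratio:
  assumes "1 / 2 \<le> r" "0 \<le> \<sigma>" "\<sigma> \<le> 2 * real m" "0 < M"
  shows "\<exists>C. \<forall>\<delta>>0. \<forall>E>0. \<delta> \<le> M * E \<longrightarrow>
    worst_case_error K (ifwt K J \<mu> x y r l m ((\<delta> / E) powr (2 / (1 + \<sigma>)))) \<sigma> E \<delta>
      \<le> ereal (C * \<delta> powr (\<sigma> / (\<sigma> + 1)) * E powr (1 / (\<sigma> + 1)))"
proof (intro exI allI impI)
  fix \<delta> E :: real assume \<delta>: "0 < \<delta>" and E: "0 < E" and le: "\<delta> \<le> M * E"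
  define A where "A = M powr (2 / (1 + \<sigma>))"
  define c where "c = min (1 / 2 ^ l) ((\<mu> 1)\<^sup>2 / (2 * A))"
  have c: "0 < c" using assms(4) mu1_pos by (simp add: c_def A_def)
  have "(\<delta> / E) powr (2 / (1 + \<sigma>)) \<le> A"
    unfolding A_def using \<delta> E le assms(2) by (intro powr_mono2) (auto simp: field_simps)
  \<comment> \<open>The witness for \<open>C\<close> is spelled out in terms of \<open>M\<close>,
    free of \<delta> and \<open>E\<close>; \<open>A\<close> and \<open>c\<close>, introduced only
    after those were fixed, are folded in afterwards.\<close>
  then show "worst_case_error K (ifwt K J \<mu> x y r l m ((\<delta> / E) powr (2 / (1 + \<sigma>)))) \<sigma> E \<delta>
      \<le> ereal ((real (nat \<lceil>r\<rceil>) ^ m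
        + real m / sqrt (min (1 / 2 ^ l) ((\<mu> 1)\<^sup>2 / (2 * M powr (2 / (1 + \<sigma>))))))
        * \<delta> powr (\<sigma> / (\<sigma> + 1)) * E powr (1 / (\<sigma> + 1)))"
    unfolding A_def[symmetric] c_def[symmetric]
    by (intro worst_case_error_le[OF assms(1-3) \<delta> E c])
      (use \<delta> E weight_lower_bound in \<open>simp add: c_def\<close>)
qed

lemma optimal_order_ifwt:
  assumes "1 / 2 \<le> r" "0 \<le> \<sigma>" "\<sigma> \<le> 2 * real m"
  shows "0 < M \<Longrightarrow> optimal_order_on {(\<delta>, E). \<delta> \<le> M * E} K (ifwt K J \<mu> x y r l m) \<sigma>"
    and "optimal_order K (ifwt K J \<mu> x y r 0 m) \<sigma>"
proof -
  show "optimal_order_on {(\<delta>, E). \<delta> \<le> M * E} K (ifwt K J \<mu> x y r l m) \<sigma>" if M: "0 < M"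
  proof -
    from worst_case_error_le_bounded_ratio[OF assms M]
    obtain C where C: "\<forall>\<delta>>0. \<forall>E>0. \<delta> \<le> M * E \<longrightarrow>
      worst_case_error K (ifwt K J \<mu> x y r l m ((\<delta> / E) powr (2 / (1 + \<sigma>)))) \<sigma> E \<delta>
        \<le> ereal (C * \<delta> powr (\<sigma> / (\<sigma> + 1)) * E powr (1 / (\<sigma> + 1)))" ..
    show ?thesis unfolding optimal_order_on_def
      by (rule exI[of _ "\<lambda>\<delta> E. (\<delta> / E) powr (2 / (1 + \<sigma>))"], rule exI[of _ C]) (simp add: C)
  qed
  \<comment> \<open>For \<open>l = 0\<close> the weight is \<open>t + \<alpha>\<close>, at least
    \<alpha> without any bound on \<alpha>, so \<open>c = 1\<close> serves for all pairs of \<delta>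
    and \<open>E\<close>.\<close>
  show "optimal_order K (ifwt K J \<mu> x y r 0 m) \<sigma>"
    unfolding optimal_order_on_def
  proof (rule exI[of _ "\<lambda>\<delta> E. (\<delta> / E) powr (2 / (1 + \<sigma>))"], intro exI allI impI conjI)
    fix \<delta> E :: real assume "0 < \<delta>" "0 < E"
    then show "0 < (\<delta> / E) powr (2 / (1 + \<sigma>))" by simp
    show "worst_case_error K (ifwt K J \<mu> x y r 0 m ((\<delta> / E) powr (2 / (1 + \<sigma>)))) \<sigma> E \<delta>
      \<le> ereal ((real (nat \<lceil>r\<rceil>) ^ m + real m / sqrt 1) * \<delta> powr (\<sigma> / (\<sigma> + 1)) * E powr (1 / (\<sigma> + 1)))"
      by (rule worst_case_error_le[OF assms \<open>0 < \<delta>\<close> \<open>0 < E\<close> zero_less_one]) (simp add: weight_def)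
  qed
qed

text \<open>For fixed \<open>E\<close> and small \<delta> the ratio \<open>\<delta> / E\<close> is
  below 1, and the power of \<open>E\<close> is absorbed into the constant.\<close>

lemma a_priori_rate_ifwt:
  assumes "1 / 2 \<le> r" "0 \<le> \<sigma>" "\<sigma> \<le> 2 * real m" "0 < E"
  shows "\<exists>C. \<forall>\<^sub>F \<delta> in at_right 0.
    worst_case_error K (ifwt K J \<mu> x y r l m ((\<delta> / E) powr (2 / (1 + \<sigma>)))) \<sigma> E \<delta>
      \<le> ereal (C * \<delta> powr (\<sigma> / (\<sigma> + 1)))"
proof -
  from worst_case_error_le_bounded_ratio[OF assms(1-3) zero_less_one, of l]
  obtain C where C: "\<forall>\<delta>>0. \<forall>E>0. \<delta> \<le> 1 * E \<longrightarrow>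
    worst_case_error K (ifwt K J \<mu> x y r l m ((\<delta> / E) powr (2 / (1 + \<sigma>)))) \<sigma> E \<delta>
      \<le> ereal (C * \<delta> powr (\<sigma> / (\<sigma> + 1)) * E powr (1 / (\<sigma> + 1)))" ..
  have "\<forall>\<^sub>F \<delta> in at_right 0. \<delta> \<in> {0<..<E}"
    by (rule eventually_at_right_real[OF assms(4)])
  then have "\<forall>\<^sub>F \<delta> in at_right 0.
    worst_case_error K (ifwt K J \<mu> x y r l m ((\<delta> / E) powr (2 / (1 + \<sigma>)))) \<sigma> E \<delta>
      \<le> ereal (C * E powr (1 / (\<sigma> + 1)) * \<delta> powr (\<sigma> / (\<sigma> + 1)))"
    by (rule eventually_mono) (use C assms(4) in \<open>simp add: mult_ac\<close>)
  then show ?thesis by (rule exI[of _ "C * E powr (1 / (\<sigma> + 1))"])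
qed

end

text \<open>The parameter exponent in the last part is the balancing one,
  \<open>2 / (1 + \<sigma>)\<close>, which agrees with \<open>2 * m / (1 + \<sigma>)\<close> for
  \<open>m = 1\<close>. That the rate is best is expressed by comparing the exponents
  \<open>\<tau> / (\<tau> + 1)\<close> over the admissible range.\<close>

theorem theorem3p5:
  fixes K :: "'a::{real_inner, banach} \<Rightarrow> 'b::{real_inner, banach}"
    and J :: "nat set" and \<mu> :: "nat \<Rightarrow> real" and x :: "nat \<Rightarrow> 'a" and y :: "nat \<Rightarrow> 'b"
    and r :: real and l m :: nat
  assumes "compact_operator K" and "K \<noteq> (\<lambda>_. 0)"
    and "singular_system K J \<mu> x y"
    and "r \<ge> 1 / 2" and "m \<ge> 1"
  shows "filter_based_regularization J \<mu> x y (ifwt_filter (\<mu> 1) r l m) (ifwt K J \<mu> x y r l m) \<and>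
    (\<forall>\<sigma>. 0 \<le> \<sigma> \<and> \<sigma> \<le> 2 * real m \<longrightarrow>
       (\<forall>M>0. optimal_order_on {(\<delta>, E). \<delta> \<le> M * E} K (ifwt K J \<mu> x y r l m) \<sigma>) \<and>
       (l = 0 \<longrightarrow> optimal_order K (ifwt K J \<mu> x y r l m) \<sigma>)) \<and>
    (\<forall>\<sigma>. \<sigma> = 2 * real m \<longrightarrow>
       (\<forall>E>0. \<exists>C. \<forall>\<^sub>F \<delta> in at_right 0.
          worst_case_error K (ifwt K J \<mu> x y r l m ((\<delta> / E) powr (2 / (1 + \<sigma>)))) \<sigma> E \<delta>
            \<le> ereal (C * \<delta> powr (2 * real m / (2 * real m + 1)))) \<and>
       (\<forall>\<tau>. 0 \<le> \<tau> \<and> \<tau> \<le> 2 * real m \<longrightarrow> \<tau> / (\<tau> + 1) \<le> 2 * real m / (2 * real m + 1)))"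
proof -
  interpret compact_singular_system K J \<mu> x y
    by unfold_locales (rule assms)+
  have "\<tau> / (\<tau> + 1) \<le> 2 * real m / (2 * real m + 1)" if "0 \<le> \<tau>" "\<tau> \<le> 2 * real m" for \<tau> :: real
    using that by (simp add: frac_le_eq divide_le_0_iff algebra_simps)
  moreover have "\<forall>E>0. \<exists>C. \<forall>\<^sub>F \<delta> in at_right 0.
      worst_case_error K (ifwt K J \<mu> x y r l m ((\<delta> / E) powr (2 / (1 + 2 * real m)))) (2 * real m) E \<delta>
        \<le> ereal (C * \<delta> powr (2 * real m / (2 * real m + 1)))"
    using a_priori_rate_ifwt[OF assms(4), of "2 * real m" m] by simp
  ultimately show ?thesis
    using filter_based_regularization_ifwt[OF assms(4,5)] optimal_order_ifwt[OF assms(4)] by simp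
qed

end
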